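(* For every fixed integer $k\ge 2$, $k\textsc{-Polygon-Circle-Recognition}$ belongs to $\mathsf{dMAM}[\log n]$: there is a three-interaction (Merlin–Arthur–Merlin) distributed interactive protocol with certificates and messages of $\mathcal{O}(\log n)$ bits that decides whether the connected $n$-node network $G$ is a $k$-polygon-circle graph, with completeness and soundness error at most $1/3$.
   Context: A $k$-polygon-circle graph is the intersection graph of a family of convex polygons with $k$ vertices, all vertices lying on a common circle. $k\textsc{-Polygon-Circle-Recognition}$ is the set of configurations $\langle G,\mathrm{id}\rangle$ with $G$ a $k$-polygon-circle graph. Distributed setting: $G=(V,E)$ is a simple connected $n$-node graph, each node has a unique identifier in $\{1,\dots,\mathrm{poly}(n)\}$, nodes know only a polynomial upper bound on $n$. A $\mathsf{dMAM}[f(n)]$ protocol: an untrusted, computationally unbounded prover (Merlin) who knows the whole configuration gives each node a certificate; then a public random string $r$ shared by all nodes (and seen by Merlin) is drawn; then Merlin gives each node a second certificate depending on $r$; finally, in one deterministic round each node sends one message to each neighbor (depending on its id, input, $r$ and certificates) and accepts or rejects. Certificates and messages have $\mathcal{O}(f(n))$ bits. Completeness: if $G$ is in the class, some prover makes all nodes accept with probability $\ge 2/3$. Soundness: if not, for every prover some node rejects with probability $\ge 2/3$. *)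

theory Defs
  imports "HOL-Analysis.Analysis" "HOL-Library.Multiset"
begin

definition simple_connected_graph :: "nat set \<Rightarrow> (nat \<Rightarrow> nat \<Rightarrow> bool) \<Rightarrow> bool" where
  "simple_connected_graph V Adj \<longleftrightarrow>
     finite V \<and> V \<noteq> {} \<and>
     (\<forall>u v. Adj u v \<longrightarrow> u \<in> V \<and> v \<in> V) \<and>
     (\<forall>u v. Adj u v \<longrightarrow> Adj v u) \<and>
     (\<forall>u. \<not> Adj u u) \<and>
     (\<forall>u\<in>V. \<forall>v\<in>V. Adj\<^sup>*\<^sup>* u v)"

definition k_polygon_circle :: "nat \<Rightarrow> nat set \<Rightarrow> (nat \<Rightarrow> nat \<Rightarrow> bool) \<Rightarrow> bool" where
  "k_polygon_circle k V Adj \<longleftrightarrow>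
     (\<exists>(z0::complex) (rad::real) (P :: nat \<Rightarrow> complex set).
        rad > 0 \<and>
        (\<forall>v\<in>V. P v \<subseteq> sphere z0 rad \<and> finite (P v) \<and> card (P v) = k) \<and>
        (\<forall>u\<in>V. \<forall>v\<in>V. u \<noteq> v \<longrightarrow>
            (Adj u v \<longleftrightarrow> convex hull (P u) \<inter> convex hull (P v) \<noteq> {})))"

text \<open>Bit strings are boolean lists. A protocol consists of
  \<^item> L N: length of the public random string, given the known upper bound N on n;
  \<^item> msg N i a b r: the message node with identifier i, first certificate a, second
    certificate b and public random string r sends to all its neighbours;
  \<^item> dec N i a b r M: the (deterministic) decision of that node after receiving the
    multiset M of messages of its neighbours.
  c1 : vertex \<Rightarrow> first certificate; c2 : random string \<Rightarrow> vertex \<Rightarrow> second certificate.\<close>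

definition received :: "(nat \<Rightarrow> nat \<Rightarrow> bool) \<Rightarrow> nat set \<Rightarrow> (nat \<Rightarrow> 'm) \<Rightarrow> nat \<Rightarrow> 'm multiset" where
  "received Adj V m v = image_mset m (mset_set {u \<in> V. Adj v u})"

definition all_accept ::
  "(nat \<Rightarrow> nat \<Rightarrow> bool list \<Rightarrow> bool list \<Rightarrow> bool list \<Rightarrow> bool list)
   \<Rightarrow> (nat \<Rightarrow> nat \<Rightarrow> bool list \<Rightarrow> bool list \<Rightarrow> bool list \<Rightarrow> bool list multiset \<Rightarrow> bool)
   \<Rightarrow> nat \<Rightarrow> nat set \<Rightarrow> (nat \<Rightarrow> nat \<Rightarrow> bool) \<Rightarrow> (nat \<Rightarrow> nat)
   \<Rightarrow> (nat \<Rightarrow> bool list) \<Rightarrow> (nat \<Rightarrow> bool list) \<Rightarrow> bool list \<Rightarrow> bool" where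
  "all_accept msg dec N V Adj ident c1 c2' r \<longleftrightarrow>
     (\<forall>v\<in>V. dec N (ident v) (c1 v) (c2' v) r
               (received Adj V (\<lambda>u. msg N (ident u) (c1 u) (c2' u) r) v))"

definition prob_bits :: "nat \<Rightarrow> (bool list \<Rightarrow> bool) \<Rightarrow> real" where
  "prob_bits l E = real (card {r :: bool list. length r = l \<and> E r}) / 2 ^ l"

text \<open>Membership of a graph class in dMAM[log n], when nodes receive a known upper
  bound N on n with n \<le> N \<le> n^d and identifiers are distinct elements of {1..n^d}.
  Certificates (of the honest prover) and messages have at most c (1 + log n) bits,
  resp. c (1 + log N) bits (which is O(log n) as N \<le> n^d).\<close>

definition dMAM_log :: "nat \<Rightarrow> (nat set \<Rightarrow> (nat \<Rightarrow> nat \<Rightarrow> bool) \<Rightarrow> bool) \<Rightarrow> bool" where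
  "dMAM_log d Cls \<longleftrightarrow>
    (\<exists>(c::real) (L :: nat \<Rightarrow> nat)
        (msg :: nat \<Rightarrow> nat \<Rightarrow> bool list \<Rightarrow> bool list \<Rightarrow> bool list \<Rightarrow> bool list)
        (dec :: nat \<Rightarrow> nat \<Rightarrow> bool list \<Rightarrow> bool list \<Rightarrow> bool list \<Rightarrow> bool list multiset \<Rightarrow> bool).
      (\<forall>N i a b r. real (length (msg N i a b r)) \<le> c * (1 + log 2 (real N))) \<and>
      (\<forall>V Adj (ident :: nat \<Rightarrow> nat) N.
         simple_connected_graph V Adj \<longrightarrow>
         inj_on ident V \<longrightarrow>
         (\<forall>v\<in>V. 1 \<le> ident v \<and> ident v \<le> card V ^ d) \<longrightarrow>
         card V \<le> N \<longrightarrow> N \<le> card V ^ d \<longrightarrow>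
         (Cls V Adj \<longrightarrow>
            (\<exists>(c1 :: nat \<Rightarrow> bool list) (c2 :: bool list \<Rightarrow> nat \<Rightarrow> bool list).
               (\<forall>v\<in>V. real (length (c1 v)) \<le> c * (1 + log 2 (real (card V)))) \<and>
               (\<forall>r. \<forall>v\<in>V. real (length (c2 r v)) \<le> c * (1 + log 2 (real (card V)))) \<and>
               prob_bits (L N) (\<lambda>r. all_accept msg dec N V Adj ident c1 (c2 r) r) \<ge> 2/3)) \<and>
         (\<not> Cls V Adj \<longrightarrow>
            (\<forall>(c1 :: nat \<Rightarrow> bool list) (c2 :: bool list \<Rightarrow> nat \<Rightarrow> bool list).
               prob_bits (L N) (\<lambda>r. \<not> all_accept msg dec N V Adj ident c1 (c2 r) r) \<ge> 2/3))))"

end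

theory Submission
  imports Defs
begin

text \<open>Cutting the circle open, a model assigns to every node \<open>k\<close> of the positions \<open>1, \<dots>, k n\<close>, and
  two nodes are adjacent iff their positions interleave. Merlin commits to the positions and, for
  each of them, to the depth, the number of polygons started minus the number of polygons ended so
  far. A node sees its neighbours' positions, so it can check that they interleave with its own and
  that in each of its inner gaps the non-neighbours start as often as they end. If all these counts
  balance, then no two non-neighbours interleave: the leftmost wrongly interleaving node has a gap
  with a surplus of starts.

  Correctness of positions and depths amounts to one multiset identity: the pairs
  (position, depth), together with \<open>(0, 0)\<close>, are the predecessor pairs together with the final pair.
  It is tested by comparing the sums of random weights in \<open>{0, \<dots>, 3}\<close>, two bits of the public
  string for each possible pair. The length of that string is not bounded in the model, so no
  finite field is needed. Merlin's second message aggregates the two sums along parent pointers.\<close>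

section \<open>Convex polygons in a circle\<close>

text \<open>A node sees only its neighbours, while a wrong crossing occurs between non-neighbours;
  this obstacle shapes the check. The balance of all polygons in a gap is a difference of two
  depths, and subtracting the visible balance of the neighbours leaves that of the non-neighbours. A
  true depth changes by a known amount, 1, 0 or -1, from one position to the next. Therefore, if the
  predecessor of every pair is again a pair or the start pair, induction from (0, 0) forces all
  claimed depths, and counting the pairs over each position forces the positions to be distinct. One
  leader contributes the start and the final pair; connectivity makes the nodes agree on it. Weights
  with four equally likely values give collision probability at most 1/4, below the allowed 1/3, and
  for fixed k the integer sums are linear in n, so they take O(log n) bits. Merlin has to fix the
  pairs before the weights are drawn, hence the message before the coin tosses. Polygons may share
  vertices, so distinct positions require a tie-breaking order that turns a shared vertex into an
  interleaving.\<close>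

definition interleaved :: "'a::linorder set \<Rightarrow> 'a set \<Rightarrow> bool" where
  "interleaved A B \<longleftrightarrow>
     (\<exists>a\<in>A. \<exists>b\<in>B. \<exists>a'\<in>A. \<exists>b'\<in>B. (a < b \<and> b < a' \<and> a' < b') \<or> (b < a \<and> a < b' \<and> b' < a'))"

lemma interleaved_sym: "interleaved A B \<Longrightarrow> interleaved B A"
  unfolding interleaved_def by blast

lemma interleavedI: "a \<in> A \<Longrightarrow> b \<in> B \<Longrightarrow> a' \<in> A \<Longrightarrow> b' \<in> B \<Longrightarrow> a < b \<Longrightarrow> b < a' \<Longrightarrow> a' < b' \<Longrightarrow> interleaved A B"
  unfolding interleaved_def by blast

text \<open>The arc of half-width \<open>h\<close> around angle 0 is where the cosine is at least
  \<open>cos h\<close>; the bound \<open>2 * pi - h\<close> keeps \<open>x\<close> from reaching the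
  next copy of that arc, around \<open>2 * pi\<close>.\<close>

lemma cos_less_outside:
  assumes "0 \<le> h" "h < \<bar>x\<bar>" "\<bar>x\<bar> < 2 * pi - h"
  shows "cos x < cos h"
proof (cases "\<bar>x\<bar> \<le> pi")
  case True
  then have "cos \<bar>x\<bar> < cos h" using assms by (intro cos_monotone_0_pi) auto
  then show ?thesis by simp
next
  case False
  then have "cos (2 * pi - \<bar>x\<bar>) < cos h" using assms by (intro cos_monotone_0_pi) auto
  then show ?thesis by (simp add: cos_diff)
qed

lemma inner_cis: "cis m \<bullet> cis t = cos (t - m)"
  by (simp add: inner_complex_def cos_diff algebra_simps)

text \<open>The line through the first and the last vertex of one set separates. If \<open>A\<close>
  starts first, a vertex of \<open>A\<close> between \<open>Min B\<close> and \<open>Max B\<close>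
  would complete an interleaving with \<open>Min A\<close>, so all of \<open>A\<close> lies outside
  the arc spanned by \<open>B\<close>.\<close>

lemma noninterleaved_hulls_disjoint:
  fixes A B :: "real set"
  assumes A: "finite A" "A \<noteq> {}" "A \<subseteq> {0..<2*pi}"
    and B: "finite B" "B \<noteq> {}" "B \<subseteq> {0..<2*pi}"
    and disj: "A \<inter> B = {}" and nc: "\<not> interleaved A B"
  shows "convex hull (cis ` A) \<inter> convex hull (cis ` B) = {}"
proof -
  have *: "convex hull (cis ` A) \<inter> convex hull (cis ` B) = {}"
    if A: "finite A" "A \<noteq> {}" "A \<subseteq> {0..<2*pi}"
    and B: "finite B" "B \<noteq> {}" "B \<subseteq> {0..<2*pi}"
    and nc: "\<not> interleaved A B" and lt: "Min A < Min B" and disj: "A \<inter> B = {}"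
    for A B :: "real set"
  proof -
    \<comment> \<open>The separating line consists of the \<open>z\<close> with
      \<open>cis m \<bullet> z = cos h\<close>. For a single point \<open>h = 0\<close> and it is
      the tangent there, so \<open>B\<close> gets the closed side and \<open>A\<close> the open
      one.\<close>
    define m h where "m = (Min B + Max B) / 2" and "h = (Max B - Min B) / 2"
    have mem: "Min B \<in> B" "Max B \<in> B" "Min A \<in> A" using A B by auto
    then have rng: "0 \<le> Min B" "Max B < 2 * pi" "Min B \<le> Max B" using B by auto
    have h: "0 \<le> h" "h \<le> pi" using rng by (auto simp: h_def)
    have "cis ` B \<subseteq> {z. cis m \<bullet> z \<ge> cos h}"
    proof clarsimp
      fix t assume "t \<in> B"
      then have "Min B \<le> t" "t \<le> Max B" using B by auto
      then have "\<bar>t - m\<bar> \<le> h" unfolding m_def h_def by (simp add: abs_le_iff field_simps)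
      then have "cos h \<le> cos \<bar>t - m\<bar>" using h by (intro cos_monotone_0_pi_le) auto
      then show "cos h \<le> cis m \<bullet> cis t" by (simp add: inner_cis)
    qed
    then have 1: "convex hull (cis ` B) \<subseteq> {z. cis m \<bullet> z \<ge> cos h}"
      by (intro hull_minimal convex_halfspace_ge)
    have "cis ` A \<subseteq> {z. cis m \<bullet> z < cos h}"
    proof clarsimp
      fix t assume t: "t \<in> A"
      have "\<not> (Min B < t \<and> t < Max B)"
        using nc interleavedI[of "Min A" A "Min B" B t "Max B"] mem t lt by auto
      moreover have "t \<noteq> Min B" "t \<noteq> Max B" using t mem disj by auto
      ultimately have "t < Min B \<or> t > Max B" by linarith
      then have "h < \<bar>t - m\<bar>" unfolding m_def h_def by (auto simp: abs_if field_simps)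
      moreover have "\<bar>t - m\<bar> < 2 * pi - h" using rng t A unfolding m_def h_def
        by (auto simp: abs_if field_simps)
      ultimately show "cis m \<bullet> cis t < cos h" using h by (simp add: inner_cis cos_less_outside)
    qed
    then have 2: "convex hull (cis ` A) \<subseteq> {z. cis m \<bullet> z < cos h}"
      by (intro hull_minimal convex_halfspace_lt)
    show ?thesis using 1 2 by force
  qed
  have "Min A \<noteq> Min B" using A B disj by (metis Min_in disjoint_iff)
  then consider "Min A < Min B" | "Min B < Min A" by linarith
  then show ?thesis
  proof cases
    case 1 then show ?thesis using * assms by blast
  next
    case 2
    have "\<not> interleaved B A" using nc interleaved_sym by blast
    then show ?thesis using *[OF B A _ 2] disj by blast
  qed
qed

text \<open>After rotation by \<open>- m\<close> the chord from \<open>a\<close> to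
  \<open>a'\<close> is the vertical one at real part \<open>cos h\<close>. The points
  \<open>b\<close> and \<open>b'\<close> lie on different sides of it, so their chord meets the
  vertical line, and a point of the unit disc on that line lies on the vertical chord.\<close>

lemma alternating_chords_meet:
  fixes a b a' b' :: real
  assumes "0 \<le> a" "a < b" "b < a'" "a' < b'" "b' < 2 * pi"
  shows "closed_segment (cis a) (cis a') \<inter> closed_segment (cis b) (cis b') \<noteq> {}"
proof -
  define m h where "m = (a + a') / 2" and "h = (a' - a) / 2"
  have h: "0 < h" "h < pi" using assms by (auto simp: h_def)
  have a: "a = m - h" "a' = m + h" by (auto simp: m_def h_def field_simps)
  have "\<bar>b - m\<bar> < h" using assms unfolding a by auto
  then have "cos h < cos \<bar>b - m\<bar>" using h by (intro cos_monotone_0_pi) auto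
  then have b: "cos h < cos (b - m)" by simp
  have b': "cos (b' - m) < cos h"
    by (rule cos_less_outside) (use assms h in \<open>auto simp: a abs_if\<close>)
  \<comment> \<open>The weight that gives the point \<open>w\<close> on the rotated chord from
    \<open>b\<close> to \<open>b'\<close> the real part \<open>cos h\<close>.\<close>
  define l where "l = (cos h - cos (b' - m)) / (cos (b - m) - cos (b' - m))"
  have l: "0 \<le> l" "l \<le> 1" using b b' by (auto simp: l_def divide_simps)
  define w where "w = l *\<^sub>R cis (b - m) + (1 - l) *\<^sub>R cis (b' - m)"
  have "norm w \<le> l * 1 + (1 - l) * 1"
    unfolding w_def by (rule norm_triangle_le) (use l in auto)
  then have "norm w \<le> 1" by simp
  then have "(norm w)\<^sup>2 \<le> 1" by (simp add: power_le_one)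
  moreover have Re: "Re w = cos h"
  proof -
    have "l * (cos (b - m) - cos (b' - m)) = cos h - cos (b' - m)"
      using b b' by (simp add: l_def)
    then show ?thesis by (simp add: w_def algebra_simps)
  qed
  ultimately have "(Im w)\<^sup>2 \<le> (sin h)\<^sup>2"
    by (simp add: cmod_power2 sin_squared_eq)
  moreover have s: "sin h > 0" using h by (simp add: sin_gt_zero)
  ultimately have Im: "\<bar>Im w\<bar> \<le> sin h" using abs_le_square_iff[of "Im w" "sin h"] by simp
  define u where "u = (Im w + sin h) / (2 * sin h)"
  have u: "0 \<le> u" "u \<le> 1" using Im s by (auto simp: u_def divide_simps)
  have "w = (1 - u) *\<^sub>R cis (- h) + u *\<^sub>R cis h"
    using s by (simp add: complex_eq_iff Re u_def field_simps)
  then have "cis m * w = cis m * ((1 - u) *\<^sub>R cis (- h) + u *\<^sub>R cis h)" by simp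
  also have "\<dots> = (1 - u) *\<^sub>R cis a + u *\<^sub>R cis a'"
    by (simp only: a distrib_left mult_scaleR_right cis_mult) simp
  finally have "cis m * w = (1 - u) *\<^sub>R cis a + u *\<^sub>R cis a'" .
  then have 1: "cis m * w \<in> closed_segment (cis a) (cis a')"
    using u unfolding closed_segment_def by blast
  have "cis m * w = (1 - (1 - l)) *\<^sub>R cis b + (1 - l) *\<^sub>R cis b'"
    by (simp add: w_def algebra_simps cis_mult)
  then have "cis m * w \<in> closed_segment (cis b) (cis b')"
    using l unfolding closed_segment_def mem_Collect_eq
    by (intro exI[of _ "1 - l"]) auto
  with 1 show ?thesis by blast
qed

lemma hulls_meet_iff_interleaved:
  fixes A B :: "real set"
  assumes A: "finite A" "A \<noteq> {}" "A \<subseteq> {0..<2*pi}"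
    and B: "finite B" "B \<noteq> {}" "B \<subseteq> {0..<2*pi}"
  shows "convex hull (cis ` A) \<inter> convex hull (cis ` B) \<noteq> {} \<longleftrightarrow> A \<inter> B \<noteq> {} \<or> interleaved A B"
proof
  assume "convex hull (cis ` A) \<inter> convex hull (cis ` B) \<noteq> {}"
  then show "A \<inter> B \<noteq> {} \<or> interleaved A B"
    using noninterleaved_hulls_disjoint[OF A B] by blast
next
  have seg: "closed_segment (cis a) (cis a') \<subseteq> convex hull (cis ` S)" if "a \<in> S" "a' \<in> S" for a a' S
    unfolding segment_convex_hull by (rule hull_mono) (use that in auto)
  assume "A \<inter> B \<noteq> {} \<or> interleaved A B"
  then show "convex hull (cis ` A) \<inter> convex hull (cis ` B) \<noteq> {}"
  proof
    assume "A \<inter> B \<noteq> {}"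
    then obtain t where "t \<in> A" "t \<in> B" by blast
    then have "cis t \<in> convex hull (cis ` A)" "cis t \<in> convex hull (cis ` B)"
      by (auto intro: hull_inc)
    then show ?thesis by blast
  next
    assume "interleaved A B"
    then obtain a b a' b' where m: "a \<in> A" "b \<in> B" "a' \<in> A" "b' \<in> B"
      and o: "(a < b \<and> b < a' \<and> a' < b') \<or> (b < a \<and> a < b' \<and> b' < a')"
      unfolding interleaved_def by blast
    have "0 \<le> a" "0 \<le> b" "a' < 2*pi" "b' < 2*pi" using m A B by auto
    then have "closed_segment (cis a) (cis a') \<inter> closed_segment (cis b) (cis b') \<noteq> {}"
      using o alternating_chords_meet[of a b a' b'] alternating_chords_meet[of b a b' a'] by blast
    then show ?thesis using seg[OF m(1) m(3)] seg[OF m(2) m(4)] by blast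
  qed
qed

text \<open>Scaling and translation carry any circle to the unit circle and commute with convex
  hulls, so only the angles of the vertices matter.\<close>

lemma k_polygon_circle_iff_angles:
  assumes "k > 0"
  shows "k_polygon_circle k V Adj \<longleftrightarrow>
    (\<exists>T :: nat \<Rightarrow> real set.
       (\<forall>v\<in>V. T v \<subseteq> {0..<2*pi} \<and> finite (T v) \<and> card (T v) = k) \<and>
       (\<forall>u\<in>V. \<forall>v\<in>V. u \<noteq> v \<longrightarrow> (Adj u v \<longleftrightarrow> T u \<inter> T v \<noteq> {} \<or> interleaved (T u) (T v))))"
    (is "_ \<longleftrightarrow> (\<exists>T. ?P T)")
proof
  assume "k_polygon_circle k V Adj"
  then obtain z0 :: complex and rad :: real and P :: "nat \<Rightarrow> complex set" where
    rad: "rad > 0" and P': "\<forall>v\<in>V. P v \<subseteq> sphere z0 rad \<and> finite (P v) \<and> card (P v) = k"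
    and Adj': "\<forall>u\<in>V. \<forall>v\<in>V. u \<noteq> v \<longrightarrow>
                 (Adj u v \<longleftrightarrow> convex hull (P u) \<inter> convex hull (P v) \<noteq> {})"
    unfolding k_polygon_circle_def by (elim exE conjE) (rule that)
  note P = P'[rule_format] and Adj = Adj'[rule_format]
  define e where "e z = z0 + rad *\<^sub>R z" for z
  define T where "T v = (\<lambda>z. Arg2pi (z - z0)) ` P v" for v
  have inj: "inj e" using rad by (auto simp: e_def inj_on_def)
  have e_cis: "e (cis (Arg2pi (z - z0))) = z" if "z \<in> sphere z0 rad" for z
  proof -
    have "norm (z - z0) = rad" using that by (simp add: dist_norm norm_minus_commute)
    then have "rad *\<^sub>R cis (Arg2pi (z - z0)) = z - z0"
      using Arg2pi_eq[of "z - z0"] by (simp add: cis_conv_exp scaleR_conv_of_real mult.commute)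
    then show ?thesis by (simp add: e_def)
  qed
  have P_eq: "P v = e ` cis ` T v" if "v \<in> V" for v
  proof -
    have "e ` cis ` T v = (\<lambda>z. z) ` P v"
      unfolding T_def image_image by (rule image_cong) (use P[OF that] e_cis in auto)
    then show ?thesis by simp
  qed
  have card: "card (T v) = k" if "v \<in> V" for v
  proof -
    have "inj_on (\<lambda>z. Arg2pi (z - z0)) (P v)"
      by (rule inj_on_inverseI[where g = "\<lambda>t. e (cis t)"]) (use P[OF that] e_cis in auto)
    then show ?thesis using P[OF that] by (simp add: T_def card_image)
  qed
  have rng: "T v \<subseteq> {0..<2*pi}" for v by (auto simp: T_def Arg2pi_ge_0 Arg2pi_lt_2pi)
  have fin: "finite (T v)" if "v \<in> V" for v using P[OF that] by (simp add: T_def)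
  have ne: "T v \<noteq> {}" if "v \<in> V" for v using card[OF that] \<open>k > 0\<close> by auto
  have "Adj u v \<longleftrightarrow> T u \<inter> T v \<noteq> {} \<or> interleaved (T u) (T v)"
    if uv: "u \<in> V" "v \<in> V" "u \<noteq> v" for u v
  proof -
    have hull: "convex hull (P w) = e ` (convex hull (cis ` T w))" if "w \<in> V" for w
      unfolding P_eq[OF that] e_def by (rule convex_hull_affinity)
    have "Adj u v \<longleftrightarrow> e ` (convex hull (cis ` T u) \<inter> convex hull (cis ` T v)) \<noteq> {}"
      using Adj[OF uv] by (simp add: hull uv image_Int[OF inj])
    also have "\<dots> \<longleftrightarrow> T u \<inter> T v \<noteq> {} \<or> interleaved (T u) (T v)"
      using hulls_meet_iff_interleaved[OF fin ne rng fin ne rng] uv by simp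
    finally show ?thesis .
  qed
  then show "\<exists>T. ?P T" using rng fin card by (intro exI[where x = T]) simp
next
  assume "\<exists>T. ?P T"
  then obtain T where T: "?P T" by blast
  have "cis ` T v \<subseteq> sphere 0 1 \<and> finite (cis ` T v) \<and> card (cis ` T v) = k" if "v \<in> V" for v
  proof -
    have "Arg2pi (cis t) = t" if "t \<in> T v" for t
      by (rule Arg2pi_unique[of 1]) (use T \<open>v \<in> V\<close> that in \<open>force simp: cis_conv_exp\<close>)+
    then have "inj_on cis (T v)" by (rule inj_on_inverseI)
    then show ?thesis using T that by (auto simp: card_image)
  qed
  moreover have "Adj u v \<longleftrightarrow> convex hull (cis ` T u) \<inter> convex hull (cis ` T v) \<noteq> {}"
    if uv: "u \<in> V" "v \<in> V" "u \<noteq> v" for u v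
  proof -
    have "T u \<noteq> {}" "T v \<noteq> {}" using T uv \<open>k > 0\<close> by force+
    then show ?thesis using T uv hulls_meet_iff_interleaved[of "T u" "T v"] by simp
  qed
  ultimately show "k_polygon_circle k V Adj"
    unfolding k_polygon_circle_def
    by (intro exI[of _ 0] exI[of _ 1] exI[of _ "\<lambda>v. cis ` T v"]) simp
qed

section \<open>Distinct vertices\<close>

text \<open>Adding \<open>2 * pi\<close> on wrap-around unrolls the circle: a polygon whose next
  vertex lies past the cut compares later than every polygon with a vertex still ahead.\<close>

definition next_vertex :: "real set \<Rightarrow> real \<Rightarrow> real" where
  "next_vertex S t = (if {s \<in> S. t < s} = {} then Min S + 2 * pi else Min {s \<in> S. t < s})"

text \<open>Points of different polygons at the same angle are ordered by their next vertex along the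
  circle. This makes polygons that share a vertex interleave.\<close>

definition point_less :: "(nat \<Rightarrow> real set) \<Rightarrow> real \<times> nat \<Rightarrow> real \<times> nat \<Rightarrow> bool" where
  "point_less T p q \<longleftrightarrow>
     fst p < fst q \<or>
     fst p = fst q \<and> (next_vertex (T (snd p)) (fst p) < next_vertex (T (snd q)) (fst q) \<or>
       next_vertex (T (snd p)) (fst p) = next_vertex (T (snd q)) (fst q) \<and> snd p < snd q)"

lemma point_less_trans: "point_less T p q \<Longrightarrow> point_less T q s \<Longrightarrow> point_less T p s"
  unfolding point_less_def by auto

lemma point_less_irrefl: "\<not> point_less T p p"
  unfolding point_less_def by auto

lemma point_less_total: "p \<noteq> q \<Longrightarrow> point_less T p q \<or> point_less T q p"
  unfolding point_less_def by (cases p, cases q) auto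

lemma next_vertex_greater:
  assumes "finite S" "t < s" "s \<in> S"
  shows "next_vertex S t \<in> S" "t < next_vertex S t"
    "\<And>s'. s' \<in> S \<Longrightarrow> t < s' \<Longrightarrow> next_vertex S t \<le> s'"
proof -
  have ne: "{s \<in> S. t < s} \<noteq> {}" using assms by blast
  then have eq: "next_vertex S t = Min {s \<in> S. t < s}" unfolding next_vertex_def by (rule if_not_P)
  have "Min {s \<in> S. t < s} \<in> {s \<in> S. t < s}" using assms(1) ne by (intro Min_in) auto
  then show "next_vertex S t \<in> S" "t < next_vertex S t" unfolding eq by auto
  show "next_vertex S t \<le> s'" if "s' \<in> S" "t < s'" for s'
    unfolding eq using assms(1) that by (intro Min_le) auto
qed

lemma next_vertex_last:
  assumes "\<And>s. s \<in> S \<Longrightarrow> s \<le> t"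
  shows "next_vertex S t = Min S + 2 * pi"
proof -
  have "{s \<in> S. t < s} = {}" using assms by force
  then show ?thesis unfolding next_vertex_def by (rule if_P)
qed

lemma card_ge_3_obtain:
  assumes "finite S" "card S \<ge> 3"
  obtains w where "w \<in> S" "w \<noteq> a" "w \<noteq> b"
proof -
  have "card {a, b} < card S" using card_insert_le_m1[of 2 "{b}" a] assms by simp
  then have "\<not> S \<subseteq> {a, b}" using card_mono[of "{a,b}" S] by auto
  then show ?thesis using that by blast
qed

lemma two_element_eq:
  assumes "card S = 2" "a \<in> S" "b \<in> S" "a \<noteq> b"
  shows "S = {a, b}"
proof -
  have "finite S" using assms(1) by (metis card.infinite zero_neq_numeral)
  then show ?thesis using assms card_subset_eq[of S "{a, b}"] by simp
qed

text \<open>One of the two patterns of \<open>interleaved\<close>, for an arbitrary relation, since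
  \<open>point_less\<close> is not the order of a type.\<close>

definition alternate :: "('a \<Rightarrow> 'a \<Rightarrow> bool) \<Rightarrow> 'a set \<Rightarrow> 'a set \<Rightarrow> bool" where
  "alternate R A B \<longleftrightarrow> (\<exists>a\<in>A. \<exists>b\<in>B. \<exists>a'\<in>A. \<exists>b'\<in>B. R a b \<and> R b a' \<and> R a' b')"

text \<open>At a common vertex \<open>z\<close> the polygon that reaches its next vertex first is
  listed first. The two copies of \<open>z\<close> in this order are consecutive terms of the
  alternating pattern, and vertices before or after \<open>z\<close> provide the others. If the next
  vertices coincide as well, a third vertex of \<open>v\<close> decides; for \<open>k = 2\<close>
  both polygons are the same chord, and the index breaks both ties alike.\<close>

lemma shared_vertex_alternate:
  fixes T :: "nat \<Rightarrow> real set"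
  assumes k: "k \<ge> 2" and u: "T u \<subseteq> {0..<2*pi}" "finite (T u)" "card (T u) = k"
    and v: "T v \<subseteq> {0..<2*pi}" "finite (T v)" "card (T v) = k"
    and z: "z \<in> T u" "z \<in> T v" and less: "point_less T (z, u) (z, v)"
  defines "PU \<equiv> (\<lambda>t. (t, u)) ` T u" and "PV \<equiv> (\<lambda>t. (t, v)) ` T v"
  shows "alternate (point_less T) PU PV \<or> alternate (point_less T) PV PU"
proof -
  have uvuv: ?thesis
    if "a \<in> T u" "b \<in> T v" "a' \<in> T u" "b' \<in> T v"
      "point_less T (a, u) (b, v)" "point_less T (b, v) (a', u)" "point_less T (a', u) (b', v)"
    for a b a' b'
    using that unfolding alternate_def PU_def PV_def by blast
  have vuvu: ?thesis
    if "b \<in> T v" "a \<in> T u" "b' \<in> T v" "a' \<in> T u"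
      "point_less T (b, v) (a, u)" "point_less T (a, u) (b', v)" "point_less T (b', v) (a', u)"
    for a b a' b'
    using that unfolding alternate_def PU_def PV_def by blast
  have lt: "point_less T (t, w) (t', w')" if "t < t'" for t t' w w'
    using that by (simp add: point_less_def)
  have ne: "T u \<noteq> {}" "T v \<noteq> {}" using z by auto
  have other: "\<exists>s\<in>S. s \<noteq> z" if "card S = k" "z \<in> S" for S :: "real set"
  proof (rule ccontr)
    assume "\<not> ?thesis"
    then have "S = {z}" using that by blast
    then show False using that k by simp
  qed
  consider (inner) a b where "a \<in> T u" "z < a" "b \<in> T v" "z < b"
    | (last_v) a where "a \<in> T u" "z < a" "\<forall>b\<in>T v. b \<le> z"
    | (last_u) "\<forall>a\<in>T u. a \<le> z"
    by (meson not_le)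
  then show ?thesis
  proof cases
    case inner
    define a0 b0 where "a0 = next_vertex (T u) z" and "b0 = next_vertex (T v) z"
    note na = next_vertex_greater[OF u(2) inner(2,1), folded a0_def]
    note nb = next_vertex_greater[OF v(2) inner(4,3), folded b0_def]
    have "a0 < b0 \<or> a0 = b0 \<and> u < v"
      using less by (auto simp: point_less_def a0_def b0_def)
    moreover have ?thesis if "a0 < b0"
      by (rule uvuv[of z z a0 b0]) (use na nb that z less lt in auto)
    moreover have ?thesis if eq: "a0 = b0" and "u < v"
    proof (cases "k = 2")
      case True
      have "T u = {z, a0}" "T v = {z, a0}" 
        by (intro two_element_eq; use u v z na nb eq True in force)+
      then have "next_vertex (T u) a0 = next_vertex (T v) a0" by simp
      then have "point_less T (a0, u) (a0, v)" using \<open>u < v\<close> by (simp add: point_less_def)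
      then show ?thesis
        by (intro uvuv[of z z a0 a0]) (use na nb z less lt eq in auto)
    next
      case False
      then obtain w where w: "w \<in> T v" "w \<noteq> z" "w \<noteq> b0"
        using card_ge_3_obtain[OF v(2), of z b0] v(3) k by auto
      then consider "w < z" | "b0 < w" using nb(3)[of w] by linarith
      then show ?thesis
      proof cases
        case 1
        then show ?thesis
          by (intro vuvu[of w z z a0]) (use na nb z w less lt in auto)
      next
        case 2
        then show ?thesis
          by (intro uvuv[of z z a0 w]) (use na nb z w eq less lt in auto)
      qed
    qed
    ultimately show ?thesis by blast
  next
    case last_v
    obtain b where "b \<in> T v" "b < z" using other[OF v(3) z(2)] last_v(3) by force
    then show ?thesis
      by (intro vuvu[of b z z a]) (use last_v z less lt in auto)
  next
    case last_u
    define a0 b0 where "a0 = Min (T u)" and "b0 = Min (T v)"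
    have a0: "a0 \<in> T u" "\<And>a. a \<in> T u \<Longrightarrow> a0 \<le> a" and b0: "b0 \<in> T v" "\<And>b. b \<in> T v \<Longrightarrow> b0 \<le> b"
      using u v ne by (auto simp: a0_def b0_def)
    have nu: "next_vertex (T u) z = a0 + 2 * pi"
      using next_vertex_last last_u unfolding a0_def by blast
    \<comment> \<open>A wrapped next vertex is at least \<open>2 * pi\<close>, so \<open>u\<close>
      can precede \<open>v\<close> at \<open>z\<close> only if \<open>v\<close> wraps as
      well.\<close>
    have last_v: "\<forall>b\<in>T v. b \<le> z"
    proof (rule ccontr)
      assume "\<not> ?thesis"
      then obtain b where "b \<in> T v" "z < b" by force
      then have "next_vertex (T v) z \<in> T v" by (rule next_vertex_greater(1)[OF v(2), rotated])
      then have "next_vertex (T v) z < 2 * pi" using v by auto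
      moreover have "0 \<le> a0" using a0 u by auto
      ultimately show False using less nu by (simp add: point_less_def)
    qed
    have nv: "next_vertex (T v) z = b0 + 2 * pi"
      using next_vertex_last last_v unfolding b0_def by blast
    have "a0 < z" using other[OF u(3) z(1)] a0 last_u by force
    have "b0 < z" using other[OF v(3) z(2)] b0 last_v by force
    have "a0 < b0 \<or> a0 = b0 \<and> u < v"
      using less nu nv by (auto simp: point_less_def)
    moreover have ?thesis if "a0 < b0"
      by (rule uvuv[of a0 b0 z z]) (use a0 b0 that \<open>b0 < z\<close> z less lt in auto)
    moreover have ?thesis if eq: "a0 = b0" and "u < v"
    proof (cases "k = 2")
      case True
      have "T u = {a0, z}" "T v = {a0, z}"
        by (intro two_element_eq; use u v z a0 b0 eq True \<open>a0 < z\<close> in force)+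
      then have "next_vertex (T u) a0 = next_vertex (T v) a0" by simp
      then have "point_less T (a0, u) (a0, v)" using \<open>u < v\<close> by (simp add: point_less_def)
      then show ?thesis
        by (intro uvuv[of a0 a0 z z]) (use a0 b0 z eq \<open>b0 < z\<close> less lt in auto)
    next
      case False
      then obtain w where w: "w \<in> T v" "w \<noteq> z" "w \<noteq> b0"
        using card_ge_3_obtain[OF v(2), of z b0] v(3) k by auto
      then have "b0 < w" "w < z" using b0 last_v by force+
      then show ?thesis
        by (intro uvuv[of a0 w z z]) (use a0 b0 eq w z less lt in auto)
    qed
    ultimately show ?thesis by blast
  qed
qed

text \<open>The positions are the ranks of all points in the order \<open>point_less\<close>.
  Polygons with a common angle interleave by \<open>shared_vertex_alternate\<close>; for two
  polygons without one, the ranks are ordered like the angles.\<close>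

lemma angle_model_imp_positions:
  fixes T :: "nat \<Rightarrow> real set"
  assumes k: "k \<ge> 2" and fin: "finite V"
    and T: "\<And>v. v \<in> V \<Longrightarrow> T v \<subseteq> {0..<2*pi} \<and> finite (T v) \<and> card (T v) = k"
  obtains A :: "nat \<Rightarrow> nat set" where
    "\<And>v. v \<in> V \<Longrightarrow> card (A v) = k" "disjoint_family_on A V" "(\<Union>v\<in>V. A v) = {1..k * card V}"
    "\<And>u v. u \<in> V \<Longrightarrow> v \<in> V \<Longrightarrow> u \<noteq> v \<Longrightarrow>
        interleaved (A u) (A v) \<longleftrightarrow> T u \<inter> T v \<noteq> {} \<or> interleaved (T u) (T v)"
proof -
  define X where "X = (\<Union>v\<in>V. (\<lambda>t. (t, v)) ` T v)"
  have finX: "finite X" using fin T by (auto simp: X_def)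
  have "card X = (\<Sum>v\<in>V. card ((\<lambda>t. (t, v)) ` T v))"
    unfolding X_def by (rule card_UN_disjoint) (use fin T in auto)
  also have "\<dots> = (\<Sum>v\<in>V. k)"
    by (intro sum.cong refl) (use T in \<open>simp add: card_image inj_on_def\<close>)
  finally have cardX: "card X = k * card V" by simp
  \<comment> \<open>The point itself is counted, so ranks start at 1 and position 0 remains free for
    the start pair.\<close>
  define rk where "rk p = card {q \<in> X. q = p \<or> point_less T q p}" for p
  have mono: "rk p < rk q" if "point_less T p q" "q \<in> X" for p q
    unfolding rk_def
  proof (rule psubset_card_mono)
    show "{x \<in> X. x = p \<or> point_less T x p} \<subset> {x \<in> X. x = q \<or> point_less T x q}"
    proof (rule psubsetI)
      show "{x \<in> X. x = p \<or> point_less T x p} \<subseteq> {x \<in> X. x = q \<or> point_less T x q}"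
        using that point_less_trans[of T] by blast
      have "q \<notin> {x \<in> X. x = p \<or> point_less T x p}"
        using that point_less_trans[of T q p q] point_less_irrefl[of T] by blast
      then show "{x \<in> X. x = p \<or> point_less T x p} \<noteq> {x \<in> X. x = q \<or> point_less T x q}"
        using that(2) by blast
    qed
  qed (use finX in auto)
  have mono_iff: "rk p < rk q \<longleftrightarrow> point_less T p q" if "p \<in> X" "q \<in> X" for p q
    using mono that point_less_total[of p q T] by (metis less_asym less_irrefl)
  have inj: "inj_on rk X"
    by (rule inj_onI) (metis mono less_irrefl point_less_total)
  have "rk ` X \<subseteq> {1..k * card V}"
  proof clarify
    fix p assume p: "p \<in> X"
    have "rk p \<le> card X" unfolding rk_def by (rule card_mono[OF finX]) auto
    moreover have "card {p} \<le> rk p" unfolding rk_def by (rule card_mono) (use p finX in auto)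
    ultimately show "rk p \<in> {1..k * card V}" using cardX by simp
  qed
  then have img: "rk ` X = {1..k * card V}"
    by (intro card_subset_eq) (auto simp: card_image inj cardX)
  define A where "A v = (\<lambda>t. rk (t, v)) ` T v" for v
  have inX: "(t, v) \<in> X" if "v \<in> V" "t \<in> T v" for t v using that by (auto simp: X_def)
  have "card (A v) = k" if "v \<in> V" for v
  proof -
    have "inj_on (\<lambda>t. rk (t, v)) (T v)"
      using inj inX[OF that] by (auto simp: inj_on_def)
    then show ?thesis using T[OF that] by (simp add: A_def card_image)
  qed
  moreover have "disjoint_family_on A V"
    unfolding disjoint_family_on_def A_def
  proof safe
    fix u v t s assume uv: "u \<in> V" "v \<in> V" "u \<noteq> v" and "t \<in> T u" "s \<in> T v" "rk (t, u) = rk (s, v)"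
    then have "(t, u) = (s, v)" using inj inX by (auto dest: inj_onD)
    then show "rk (t, u) \<in> {}" using uv by simp
  qed
  moreover have "(\<Union>v\<in>V. A v) = {1..k * card V}"
    unfolding img[symmetric] A_def X_def by auto
  moreover have "interleaved (A u) (A v) \<longleftrightarrow> T u \<inter> T v \<noteq> {} \<or> interleaved (T u) (T v)"
    if uv: "u \<in> V" "v \<in> V" "u \<noteq> v" for u v
  proof -
    define PU PV where "PU = (\<lambda>t. (t, u)) ` T u" and "PV = (\<lambda>t. (t, v)) ` T v"
    have sub: "PU \<subseteq> X" "PV \<subseteq> X" using uv by (auto simp: PU_def PV_def inX)
    have A_eq: "A u = rk ` PU" "A v = rk ` PV" by (auto simp: A_def PU_def PV_def image_image)
    have rk_iff: "rk p < rk q \<longleftrightarrow> point_less T p q" if "p \<in> PU \<or> p \<in> PV" "q \<in> PU \<or> q \<in> PV" for p q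
      using mono_iff that sub by blast
    have int: "interleaved (A u) (A v) \<longleftrightarrow> alternate (point_less T) PU PV \<or> alternate (point_less T) PV PU"
    proof -
      have "interleaved (A u) (A v) \<longleftrightarrow>
        (\<exists>a\<in>PU. \<exists>b\<in>PV. \<exists>a'\<in>PU. \<exists>b'\<in>PV. (rk a < rk b \<and> rk b < rk a' \<and> rk a' < rk b')
            \<or> (rk b < rk a \<and> rk a < rk b' \<and> rk b' < rk a'))"
        unfolding interleaved_def A_eq by simp
      also have "\<dots> \<longleftrightarrow>
        (\<exists>a\<in>PU. \<exists>b\<in>PV. \<exists>a'\<in>PU. \<exists>b'\<in>PV.
          (point_less T a b \<and> point_less T b a' \<and> point_less T a' b')
            \<or> (point_less T b a \<and> point_less T a b' \<and> point_less T b' a'))"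
        by (intro bex_cong refl) (simp add: rk_iff)
      also have "\<dots> \<longleftrightarrow> alternate (point_less T) PU PV \<or> alternate (point_less T) PV PU"
        unfolding alternate_def by blast
      finally show ?thesis .
    qed
    show ?thesis
    proof (cases "T u \<inter> T v = {}")
      case False
      then obtain z where z: "z \<in> T u" "z \<in> T v" by blast
      have "point_less T (z, u) (z, v) \<or> point_less T (z, v) (z, u)"
        using uv by (intro point_less_total) simp
      then have "alternate (point_less T) PU PV \<or> alternate (point_less T) PV PU"
        using shared_vertex_alternate[OF k, of T u v z] shared_vertex_alternate[OF k, of T v u z] z T uv
        unfolding PU_def PV_def by blast
      then show ?thesis using int False by blast
    next
      case True
      have "point_less T (t, u) (s, v) \<longleftrightarrow> t < s" "point_less T (s, v) (t, u) \<longleftrightarrow> s < t"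
        if "t \<in> T u" "s \<in> T v" for t s
        using True that by (auto simp: point_less_def)
      then have "alternate (point_less T) PU PV \<or> alternate (point_less T) PV PU \<longleftrightarrow> interleaved (T u) (T v)"
        unfolding alternate_def interleaved_def PU_def PV_def by (simp; blast)
      then show ?thesis using int True by blast
    qed
  qed
  ultimately show ?thesis using that by blast
qed

lemma positions_imp_k_polygon_circle:
  fixes A :: "nat \<Rightarrow> nat set"
  assumes "k > 0" and fin: "finite V" and A: "\<And>v. v \<in> V \<Longrightarrow> finite (A v) \<and> card (A v) = k"
    and disj: "\<And>u v. u \<in> V \<Longrightarrow> v \<in> V \<Longrightarrow> u \<noteq> v \<Longrightarrow> A u \<inter> A v = {}"
    and Adj: "\<And>u v. u \<in> V \<Longrightarrow> v \<in> V \<Longrightarrow> u \<noteq> v \<Longrightarrow> Adj u v \<longleftrightarrow> interleaved (A u) (A v)"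
  shows "k_polygon_circle k V Adj"
proof -
  \<comment> \<open>One more than the largest position, so that all angles \<open>e x\<close> stay
    below \<open>2 * pi\<close>.\<close>
  define M where "M = Suc (Max (\<Union>v\<in>V. A v))"
  have lt: "x < M" if "v \<in> V" "x \<in> A v" for v x
    unfolding M_def less_Suc_eq_le by (rule Max_ge) (use that fin A in auto)
  define e where "e x = 2 * pi * real x / real M" for x
  have M: "real M > 0" by (simp add: M_def)
  have e_less: "e x < e y \<longleftrightarrow> x < y" for x y using M by (simp add: e_def divide_simps)
  have inj: "inj_on e S" for S using M by (auto simp: inj_on_def e_def)
  have "e ` A v \<subseteq> {0..<2*pi} \<and> finite (e ` A v) \<and> card (e ` A v) = k" if "v \<in> V" for v
    using A[OF that] lt[OF that] M card_image[OF inj, of "A v"] by (auto simp: e_def divide_simps)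
  moreover have "Adj u v \<longleftrightarrow> e ` A u \<inter> e ` A v \<noteq> {} \<or> interleaved (e ` A u) (e ` A v)"
    if "u \<in> V" "v \<in> V" "u \<noteq> v" for u v
  proof -
    have "e ` A u \<inter> e ` A v = {}" using disj[OF that] by (simp flip: image_Int[OF inj])
    moreover have "interleaved (e ` A u) (e ` A v) = interleaved (A u) (A v)"
      unfolding interleaved_def by (simp add: e_less)
    ultimately show ?thesis using Adj[OF that] by simp
  qed
  ultimately show ?thesis
    unfolding k_polygon_circle_iff_angles[OF \<open>k > 0\<close>] by (intro exI[of _ "\<lambda>v. e ` A v"]) blast
qed

section \<open>Counting starts and ends in gaps\<close>

definition gap_balance :: "nat list \<Rightarrow> nat \<Rightarrow> nat \<Rightarrow> int" where
  "gap_balance ys a b = of_bool (a < hd ys \<and> hd ys < b) - of_bool (a < last ys \<and> last ys < b)"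

lemma sorted_hd_last_bounds:
  fixes ys :: "nat list"
  assumes "sorted_wrt (<) ys" "y \<in> set ys"
  shows "hd ys \<le> y" "y \<le> last ys"
proof -
  show "hd ys \<le> y" using assms by (cases ys) auto
  show "y \<le> last ys" using assms by (cases ys rule: rev_cases) (auto simp: sorted_wrt_append)
qed

lemma between_consecutive:
  fixes zs :: "nat list"
  assumes "zs \<noteq> []" "sorted_wrt (<) zs" "hd zs < y" "y < last zs" "y \<notin> set zs"
  shows "\<exists>j. Suc j < length zs \<and> zs ! j < y \<and> y < zs ! Suc j"
  using assms
proof (induction zs rule: induct_list012)
  case (3 a b zs)
  show ?case
  proof (cases "y < b")
    case True
    then show ?thesis using 3 by (intro exI[of _ 0]) auto
  next
    case False
    then have "hd (b # zs) < y" using 3 by auto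
    then obtain j where "Suc j < length (b # zs)" "(b # zs) ! j < y" "y < (b # zs) ! Suc j"
      using 3 by auto
    then show ?thesis by (intro exI[of _ "Suc j"]) auto
  qed
qed auto

lemma consecutive_gap_empty:
  fixes zs :: "nat list"
  assumes "sorted_wrt (<) zs" "Suc j < length zs" "x \<in> set zs"
  shows "\<not> (zs ! j < x \<and> x < zs ! Suc j)"
proof
  obtain i where i: "i < length zs" "x = zs ! i" using assms by (metis in_set_conv_nth)
  have mono: "zs ! p \<le> zs ! q" if "p \<le> q" "q < length zs" for p q
    using sorted_wrt_nth_less[OF assms(1), of p q] that by (cases "p = q") auto
  assume "zs ! j < x \<and> x < zs ! Suc j"
  then show False using mono[of i j] mono[of "Suc j" i] i assms by (cases "i \<le> j") auto
qed

text \<open>Only a polygon with exactly one of its two ends inside the gap has nonzero balance. Then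
  \<open>a\<close>, \<open>b\<close> and the two ends alternate; disjointness excludes that an end
  coincides with \<open>a\<close> or \<open>b\<close>.\<close>

lemma gap_balance_eq_0:
  fixes xs ys :: "nat list"
  assumes ys: "ys \<noteq> []" "sorted_wrt (<) ys" and ab: "a \<in> set xs" "b \<in> set xs"
    and disj: "set xs \<inter> set ys = {}" and nc: "\<not> interleaved (set xs) (set ys)"
  shows "gap_balance ys a b = 0"
proof -
  have mem: "hd ys \<in> set ys" "last ys \<in> set ys" using ys by auto
  have le: "hd ys \<le> last ys" using sorted_hd_last_bounds[OF ys(2)] mem by blast
  have ne: "hd ys \<noteq> a" "hd ys \<noteq> b" "last ys \<noteq> a" "last ys \<noteq> b" using mem ab disj by auto
  have "\<not> (a < hd ys \<and> hd ys < b \<and> b < last ys)" "\<not> (hd ys < a \<and> a < last ys \<and> last ys < b)"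
    using nc ab mem unfolding interleaved_def by blast+
  then show ?thesis using le ne unfolding gap_balance_def by (auto simp: of_bool_def)
qed

text \<open>Among the nodes of wrong crossings choose \<open>v\<close> with the leftmost start, and among its wrong
  partners \<open>u\<close> with the leftmost start. The gap of \<open>v\<close> in which \<open>u\<close> starts then contains a wrong
  start but the end of no polygon whose start lies elsewhere, so its balance is positive.\<close>

lemma balanced_gaps_imp_not_interleaved:
  fixes xs :: "nat \<Rightarrow> nat list"
  assumes fin: "finite V"
    and sorted: "\<And>v. v \<in> V \<Longrightarrow> sorted_wrt (<) (xs v)" and ne: "\<And>v. v \<in> V \<Longrightarrow> xs v \<noteq> []"
    and disj: "\<And>u v. u \<in> V \<Longrightarrow> v \<in> V \<Longrightarrow> u \<noteq> v \<Longrightarrow> set (xs u) \<inter> set (xs v) = {}"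
    and sym: "\<And>u v. Adj u v \<Longrightarrow> Adj v u"
    and bal: "\<And>v j. v \<in> V \<Longrightarrow> Suc j < length (xs v) \<Longrightarrow>
        (\<Sum>u | u \<in> V \<and> \<not> Adj v u. gap_balance (xs u) (xs v ! j) (xs v ! Suc j)) = 0"
    and "u \<in> V" "v \<in> V" "u \<noteq> v" "\<not> Adj u v"
  shows "\<not> interleaved (set (xs u)) (set (xs v))"
proof
  define bad where
    "bad u v \<longleftrightarrow> u \<in> V \<and> v \<in> V \<and> u \<noteq> v \<and> \<not> Adj u v \<and> interleaved (set (xs u)) (set (xs v))" for u v
  have bad_sym: "bad v u" if "bad u v" for u v
    using that sym interleaved_sym unfolding bad_def by blast
  assume "interleaved (set (xs u)) (set (xs v))"
  then have "\<exists>u. bad u v" using assms unfolding bad_def by blast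
  then obtain v where v: "\<exists>u. bad u v"
    and v_min: "\<And>w. \<exists>u. bad u w \<Longrightarrow> hd (xs v) \<le> hd (xs w)"
    using ex_has_least_nat[of "\<lambda>v. \<exists>u. bad u v" v "\<lambda>v. hd (xs v)"] by blast
  from v obtain u0 where "bad u0 v" by blast
  then obtain u where u: "bad u v" and u_min: "\<And>w. bad w v \<Longrightarrow> hd (xs u) \<le> hd (xs w)"
    using ex_has_least_nat[of "\<lambda>u. bad u v" u0 "\<lambda>u. hd (xs u)"] by blast
  have V: "u \<in> V" "v \<in> V" "u \<noteq> v" "\<not> Adj v u" using u sym by (auto simp: bad_def)
  have int: "interleaved (set (xs u)) (set (xs v))" using u by (simp add: bad_def)
  have mem: "hd (xs w) \<in> set (xs w)" "last (xs w) \<in> set (xs w)" if "w \<in> V" for w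
    using ne[OF that] by auto
  note bnd = sorted_hd_last_bounds[OF sorted]
  have notin: "x \<notin> set (xs v)" if "x \<in> set (xs u)" for x using that disj V by blast
  \<comment> \<open>By symmetry \<open>u\<close> also belongs to a wrong crossing, so
    \<open>v\<close> starts no later; disjointness makes this strict.\<close>
  have "hd (xs v) < hd (xs u)"
    using v_min[of u] bad_sym[OF u] notin[OF mem(1)] mem(1)[of v] V by (metis le_neq_implies_less)
  moreover have "hd (xs u) < last (xs v)"
  proof (rule ccontr)
    assume "\<not> ?thesis"
    then have "y \<le> x" if "x \<in> set (xs u)" "y \<in> set (xs v)" for x y
      using bnd(1)[OF V(1) that(1)] bnd(2)[OF V(2) that(2)] by linarith
    then show False using int unfolding interleaved_def by (meson not_le)
  qed
  ultimately obtain j where j: "Suc j < length (xs v)" "xs v ! j < hd (xs u)" "hd (xs u) < xs v ! Suc j"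
    using between_consecutive[OF ne[OF V(2)] sorted[OF V(2)]] notin[OF mem(1)] V by blast
  define a b where "a = xs v ! j" and "b = xs v ! Suc j"
  have ab: "a \<in> set (xs v)" "b \<in> set (xs v)" using j by (auto simp: a_def b_def)
  have empty: "\<not> (a < x \<and> x < b)" if "x \<in> set (xs v)" for x
    using consecutive_gap_empty[OF sorted[OF V(2)] j(1) that] by (simp add: a_def b_def)
  \<comment> \<open>\<open>v\<close> has no vertex inside its own gap. A wrong partner starts no
    earlier than \<open>u\<close>, hence after \<open>a\<close>, so its end lies in the gap only if
    its start does. All others are balanced by \<open>gap_balance_eq_0\<close>.\<close>
  have nonneg: "gap_balance (xs w) a b \<ge> 0" if w: "w \<in> V" "\<not> Adj v w" for w
  proof -
    consider "w = v" | "w \<noteq> v" "bad w v" | "w \<noteq> v" "\<not> bad w v" by blast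
    then show ?thesis
    proof cases
      case 1
      then show ?thesis using empty mem[OF V(2)] by (auto simp: gap_balance_def)
    next
      case 2
      have "hd (xs u) \<le> hd (xs w)" "hd (xs w) \<le> last (xs w)"
        using u_min[OF 2(2)] bnd(1)[OF w(1) mem(2)[OF w(1)]] by auto
      then show ?thesis using j by (auto simp: gap_balance_def a_def b_def of_bool_def)
    next
      case 3
      then have "\<not> interleaved (set (xs v)) (set (xs w))"
        using w V sym interleaved_sym unfolding bad_def by blast
      then have "gap_balance (xs w) a b = 0"
        using 3 w V disj by (intro gap_balance_eq_0[OF ne sorted ab]) auto
      then show ?thesis by simp
    qed
  qed
  \<comment> \<open>If \<open>u\<close> ended in the gap, all its vertices would lie between two
    consecutive vertices of \<open>v\<close>, and it would not interleave with
    \<open>v\<close>.\<close>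
  have "\<not> last (xs u) < b"
  proof
    assume "last (xs u) < b"
    then have in_gap: "a < x \<and> x < b" if "x \<in> set (xs u)" for x
      using bnd[OF V(1) that] j by (simp add: a_def b_def)
    then show False using int empty unfolding interleaved_def by (meson less_trans)
  qed
  then have "gap_balance (xs u) a b = 1" using j by (simp add: gap_balance_def a_def b_def)
  moreover have "gap_balance (xs u) a b \<le> (\<Sum>w | w \<in> V \<and> \<not> Adj v w. gap_balance (xs w) a b)"
    by (rule member_le_sum) (use V nonneg fin in auto)
  moreover have "\<dots> = 0" using bal[OF V(2) j(1)] by (simp add: a_def b_def)
  ultimately show False by simp
qed

section \<open>Depth along the opened circle\<close>

text \<open>Starts and ends both count with \<le>, so a polygon is closed at its own last position.
  Hence the depth is 0 at the end of the circle, and the depth just before a position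
  \<open>b\<close> is read at \<open>b - 1\<close>.\<close>

definition depth :: "(nat \<Rightarrow> nat list) \<Rightarrow> nat set \<Rightarrow> nat \<Rightarrow> int" where
  "depth xs V y = (\<Sum>u\<in>V. of_bool (hd (xs u) \<le> y) - of_bool (last (xs u) \<le> y))"

text \<open>The change of depth at the \<open>j\<close>-th vertex of a polygon whose first and last
  vertex differ.\<close>

definition step :: "nat \<Rightarrow> nat \<Rightarrow> int" where
  "step k j = (if j = 0 then 1 else if Suc j = k then - 1 else 0)"

text \<open>The sum over the whole network becomes a difference of two depths, which lets a node
  account for polygons that it cannot see.\<close>

lemma depth_gap:
  assumes "a < b"
  shows "depth xs V (b - 1) - depth xs V a = (\<Sum>u\<in>V. gap_balance (xs u) a b)"
  unfolding depth_def sum_subtractf[symmetric]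
  by (rule sum.cong) (use assms in \<open>auto simp: gap_balance_def of_bool_def\<close>)

text \<open>By disjointness \<open>v\<close> is the only polygon with a vertex at this position, so
  no other start or end changes the depth there. The assumption \<open>pos\<close> keeps the
  truncated subtraction exact.\<close>

lemma depth_step:
  assumes fin: "finite V" and k: "k \<ge> 2"
    and xs: "\<And>v. v \<in> V \<Longrightarrow> sorted_wrt (<) (xs v) \<and> length (xs v) = k"
    and disj: "\<And>u v. u \<in> V \<Longrightarrow> v \<in> V \<Longrightarrow> u \<noteq> v \<Longrightarrow> set (xs u) \<inter> set (xs v) = {}"
    and v: "v \<in> V" "j < k" and pos: "xs v ! j \<ge> 1"
  shows "depth xs V (xs v ! j - 1) = depth xs V (xs v ! j) - step k j"
proof -
  define x where "x = xs v ! j"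
  have ne: "xs u \<noteq> []" if "u \<in> V" for u using xs[OF that] k by auto
  have x: "x \<in> set (xs v)" using v xs by (auto simp: x_def)
  have "depth xs V x - depth xs V (x - 1) = (\<Sum>u\<in>V. of_bool (hd (xs u) = x) - of_bool (last (xs u) = x))"
    unfolding depth_def sum_subtractf[symmetric]
    by (rule sum.cong) (use pos in \<open>auto simp: x_def of_bool_def\<close>)
  also have "\<dots> = (\<Sum>u\<in>{v}. of_bool (hd (xs u) = x) - of_bool (last (xs u) = x))"
  proof (rule sum.mono_neutral_right)
    show "\<forall>u\<in>V - {v}. of_bool (hd (xs u) = x) - of_bool (last (xs u) = x) = (0::int)"
    proof
      fix u assume u: "u \<in> V - {v}"
      then have "hd (xs u) \<in> set (xs u)" "last (xs u) \<in> set (xs u)" using ne by auto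
      then have "hd (xs u) \<noteq> x" "last (xs u) \<noteq> x" using disj[of u v] u v x by auto
      then show "of_bool (hd (xs u) = x) - of_bool (last (xs u) = x) = (0::int)" by simp
    qed
  qed (use fin v in auto)
  also have "\<dots> = step k j"
  proof -
    have "distinct (xs v)" using xs[OF v(1)] strict_sorted_iff by blast
    then have eq: "xs v ! i = x \<longleftrightarrow> i = j" if "i < k" for i
      using that v xs unfolding x_def by (simp add: nth_eq_iff_index_eq)
    have "hd (xs v) = xs v ! 0" "last (xs v) = xs v ! (k - 1)"
      using ne[OF v(1)] xs[OF v(1)] by (auto simp: hd_conv_nth last_conv_nth)
    then show ?thesis using eq[of 0] eq[of "k - 1"] k by (auto simp: step_def)
  qed
  finally show ?thesis by (simp add: x_def)
qed

section \<open>The chain of pairs and their predecessors\<close>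

text \<open>For a true model the pairs form a chain from (0, 0) to the last position with depth 0,
  one link per vertex. The leader contributes both end pairs, the first here and the second in
  \<open>chain_preds\<close>. Depth is an integer since a false claim minus \<open>step\<close> may
  be -1.\<close>

definition chain_items :: "nat \<Rightarrow> bool \<Rightarrow> nat list \<Rightarrow> nat list \<Rightarrow> (nat \<times> int) multiset" where
  "chain_items k lead xs ds =
     image_mset (\<lambda>j. (xs ! j, int (ds ! j))) (mset_set {..<k}) + (if lead then {#(0, 0)#} else {#})"

definition chain_preds :: "nat \<Rightarrow> bool \<Rightarrow> nat \<Rightarrow> nat list \<Rightarrow> nat list \<Rightarrow> (nat \<times> int) multiset" where
  "chain_preds k lead e xs ds =
     image_mset (\<lambda>j. (xs ! j - 1, int (ds ! j) - step k j)) (mset_set {..<k}) + (if lead then {#(e, 0)#} else {#})"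

lemma sum_mset_image_sum:
  fixes f :: "'a \<Rightarrow> 'b multiset" and g :: "'b \<Rightarrow> 'c::comm_monoid_add"
  shows "(\<Sum>p\<in>#(\<Sum>v\<in>V. f v). g p) = (\<Sum>v\<in>V. \<Sum>p\<in>#f v. g p)"
  by (induction V rule: infinite_finite_induct) auto

lemma in_sum_mset_iff: "finite V \<Longrightarrow> p \<in># (\<Sum>v\<in>V. f v) \<longleftrightarrow> (\<exists>v\<in>V. p \<in># f v)"
  by (induction V rule: finite_induct) auto

lemma sum_mset_subset:
  assumes "finite V" "\<And>v. v \<in> V \<Longrightarrow> set_mset (f v) \<subseteq> S"
  shows "set_mset (\<Sum>v\<in>V. f v) \<subseteq> S"
  using assms by (induction V rule: finite_induct) auto

lemma sum_chain_items:
  fixes g :: "nat \<times> int \<Rightarrow> 'a::semiring_1"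
  shows "(\<Sum>p\<in>#chain_items k lead xs ds. g p) = (\<Sum>j<k. g (xs ! j, int (ds ! j))) + of_bool lead * g (0, 0)"
  by (simp add: chain_items_def sum_unfold_sum_mset image_mset.compositionality comp_def)

lemma sum_chain_preds:
  fixes g :: "nat \<times> int \<Rightarrow> 'a::semiring_1"
  shows "(\<Sum>p\<in>#chain_preds k lead e xs ds. g p) =
    (\<Sum>j<k. g (xs ! j - 1, int (ds ! j) - step k j)) + of_bool lead * g (e, 0)"
  by (simp add: chain_preds_def sum_unfold_sum_mset image_mset.compositionality comp_def)

context
  fixes V :: "nat set" and k :: nat and lead :: "nat \<Rightarrow> bool" and xs ds :: "nat \<Rightarrow> nat list"
  assumes fin: "finite V" and k: "k \<ge> 2"
    and xs: "\<And>v. v \<in> V \<Longrightarrow> sorted_wrt (<) (xs v) \<and> length (xs v) = k"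
    and pos: "\<And>v x. v \<in> V \<Longrightarrow> x \<in> set (xs v) \<Longrightarrow> x \<ge> 1"
begin

text \<open>Let \<open>c m\<close> count the vertices at position \<open>m\<close>. The vertices at
  \<open>m + 1\<close> have predecessor pairs over \<open>m\<close>, which by the identity are
  elements over \<open>m\<close>, so \<open>c\<close> cannot grow except from 0 to 1 by the leader's
  start pair. As \<open>c 0 = 0\<close>, no position is used twice. The depths follow from the same
  predecessors by induction on the position.\<close>

lemma chain_sound:
  assumes lead: "\<And>u v. u \<in> V \<Longrightarrow> v \<in> V \<Longrightarrow> lead u \<Longrightarrow> lead v \<Longrightarrow> u = v"
    and eq: "(\<Sum>v\<in>V. chain_items k (lead v) (xs v) (ds v)) = (\<Sum>v\<in>V. chain_preds k (lead v) (e v) (xs v) (ds v))"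
  shows chain_disjoint: "\<And>u v. u \<in> V \<Longrightarrow> v \<in> V \<Longrightarrow> u \<noteq> v \<Longrightarrow> set (xs u) \<inter> set (xs v) = {}"
    and chain_depth: "\<And>v j. v \<in> V \<Longrightarrow> j < k \<Longrightarrow> int (ds v ! j) = depth xs V (xs v ! j)"
proof -
  have nth_pos: "xs v ! j \<ge> 1" if "v \<in> V" "j < k" for v j using pos xs that by simp
  define c where "c m = (\<Sum>v\<in>V. \<Sum>j<k. of_bool (xs v ! j = m) :: nat)" for m
  have c_Suc: "c (Suc m) \<le> c m + of_bool (m = 0)" for m
  proof -
    define g :: "nat \<times> int \<Rightarrow> nat" where "g p = of_bool (fst p = m)" for p
    have "c (Suc m) = (\<Sum>v\<in>V. \<Sum>j<k. g (xs v ! j - 1, int (ds v ! j) - step k j))"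
      unfolding c_def
    proof (intro sum.cong refl)
      fix v j assume "v \<in> V" "j \<in> {..<k}"
      then have "xs v ! j \<ge> 1" using nth_pos by simp
      then show "of_bool (xs v ! j = Suc m) = g (xs v ! j - 1, int (ds v ! j) - step k j)"
        by (auto simp: g_def of_bool_def)
    qed
    also have "\<dots> \<le> (\<Sum>v\<in>V. \<Sum>p\<in>#chain_preds k (lead v) (e v) (xs v) (ds v). g p)"
      by (intro sum_mono) (simp add: sum_chain_preds)
    also have "\<dots> = (\<Sum>v\<in>V. \<Sum>p\<in>#chain_items k (lead v) (xs v) (ds v). g p)"
      using eq by (simp flip: sum_mset_image_sum)
    also have "\<dots> = c m + (\<Sum>v\<in>V. of_bool (lead v)) * of_bool (m = 0)"
      by (auto simp: sum_chain_items sum.distrib c_def g_def sum_distrib_right)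
    also have "(\<Sum>v\<in>V. of_bool (lead v)) \<le> (1::nat)"
    proof -
      have "(\<Sum>v\<in>V. of_bool (lead v)) = card {v \<in> V. lead v}"
        using fin by (simp add: Int_def)
      moreover have "card {v \<in> V. lead v} \<le> Suc 0"
        using fin lead by (subst card_le_Suc0_iff_eq) auto
      ultimately show ?thesis by simp
    qed
    finally show ?thesis by simp
  qed
  have "c 0 = 0" unfolding c_def by (intro sum.neutral ballI) (use nth_pos in force)
  then have "c 1 \<le> 1" using c_Suc[of 0] by simp
  have c_le: "c m \<le> 1" for m
  proof (induction m)
    case (Suc m)
    then show ?case using c_Suc[of m] \<open>c 1 \<le> 1\<close> by (cases "m = 0") auto
  qed (simp add: \<open>c 0 = 0\<close>)
  show disj: "set (xs u) \<inter> set (xs v) = {}" if uv: "u \<in> V" "v \<in> V" "u \<noteq> v" for u v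
  proof (rule ccontr)
    assume "\<not> ?thesis"
    then obtain x where x: "x \<in> set (xs u)" "x \<in> set (xs v)" by blast
    have one: "1 \<le> (\<Sum>j<k. of_bool (xs w ! j = x) :: nat)" if w: "w \<in> V" "x \<in> set (xs w)" for w
    proof -
      obtain j where "j < k" "xs w ! j = x" using w xs[OF w(1)] by (auto simp: in_set_conv_nth)
      then show ?thesis using member_le_sum[of j "{..<k}" "\<lambda>j. of_bool (xs w ! j = x) :: nat"] by simp
    qed
    have "(\<Sum>w\<in>{u, v}. \<Sum>j<k. of_bool (xs w ! j = x) :: nat) \<le> c x"
      unfolding c_def by (rule sum_mono2) (use fin uv in auto)
    then show False using one[OF uv(1) x(1)] one[OF uv(2) x(2)] uv c_le[of x] by simp
  qed
  have "\<forall>v j. v \<in> V \<longrightarrow> j < k \<longrightarrow> xs v ! j = x \<longrightarrow> int (ds v ! j) = depth xs V x" for x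
  proof (induction x rule: less_induct)
    case (less x)
    show ?case
    proof (intro allI impI)
      fix v j assume v: "v \<in> V" "j < k" and x: "xs v ! j = x"
      have x1: "x \<ge> 1" using nth_pos[OF v] x by simp
      have "(x - 1, int (ds v ! j) - step k j) \<in># chain_preds k (lead v) (e v) (xs v) (ds v)"
        using v x by (auto simp: chain_preds_def)
      then have "(x - 1, int (ds v ! j) - step k j) \<in># (\<Sum>v\<in>V. chain_items k (lead v) (xs v) (ds v))"
        unfolding eq in_sum_mset_iff[OF fin] using v by blast
      then obtain u where u: "u \<in> V" "(x - 1, int (ds v ! j) - step k j) \<in># chain_items k (lead u) (xs u) (ds u)"
        unfolding in_sum_mset_iff[OF fin] by blast
      then consider i where "i < k" "xs u ! i = x - 1" "int (ds u ! i) = int (ds v ! j) - step k j"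
        | "x - 1 = 0" "int (ds v ! j) - step k j = 0"
        by (auto simp: chain_items_def split: if_splits)
      then have "int (ds v ! j) - step k j = depth xs V (x - 1)"
      proof cases
        case 1
        then show ?thesis using less[of "x - 1"] u x1 by auto
      next
        \<comment> \<open>The predecessor is the start pair; all positions are at least 1, so the
          true depth at 0 is 0.\<close>
        case 2
        have "hd (xs u) \<ge> 1 \<and> last (xs u) \<ge> 1" if "u \<in> V" for u
          using pos[OF that] xs[OF that] k by (metis hd_in_set last_in_set list.size(3) not_numeral_le_zero)
        then have "depth xs V 0 = 0" unfolding depth_def by (intro sum.neutral) force
        then show ?thesis using 2 by simp
      qed
      moreover have "depth xs V (x - 1) = depth xs V x - step k j"
        using depth_step[where xs = xs, OF fin k xs disj v] x x1 by simp
      ultimately show "int (ds v ! j) = depth xs V x" by simp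
    qed
  qed
  then show "int (ds v ! j) = depth xs V (xs v ! j)" if "v \<in> V" "j < k" for v j
    using that by blast
qed

text \<open>With \<open>D x\<close> the value of \<open>g\<close> at the true pair over
  \<open>x\<close>, the vertices contribute the telescoping sum of \<open>D x - D (x - 1)\<close>
  over 1 to \<open>K\<close>, and the leader cancels its two ends because the depth is 0 at 0 and at
  \<open>K\<close>. As \<open>g\<close> is arbitrary, an honest chain passes for every random
  string.\<close>

lemma chain_complete:
  fixes g :: "nat \<times> int \<Rightarrow> int"
  assumes disj: "\<And>u v. u \<in> V \<Longrightarrow> v \<in> V \<Longrightarrow> u \<noteq> v \<Longrightarrow> set (xs u) \<inter> set (xs v) = {}"
    and un: "(\<Union>v\<in>V. set (xs v)) = {1..K}"
    and ds: "\<And>v j. v \<in> V \<Longrightarrow> j < k \<Longrightarrow> int (ds v ! j) = depth xs V (xs v ! j)"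
    and lead: "l \<in> V" "\<And>v. v \<in> V \<Longrightarrow> lead v \<longleftrightarrow> v = l"
  shows "(\<Sum>v\<in>V. (\<Sum>p\<in>#chain_items k (lead v) (xs v) (ds v). g p)
            - (\<Sum>p\<in>#chain_preds k (lead v) K (xs v) (ds v). g p)) = 0"
proof -
  define D where "D x = g (x, depth xs V x)" for x
  have ends: "hd (xs u) \<in> {1..K} \<and> last (xs u) \<in> {1..K}" if "u \<in> V" for u
  proof -
    have "xs u \<noteq> []" using xs[OF that] k by auto
    then show ?thesis using un that hd_in_set[of "xs u"] last_in_set[of "xs u"] by blast
  qed
  have d0: "depth xs V 0 = 0" unfolding depth_def by (intro sum.neutral) (use ends in force)
  have dK: "depth xs V K = 0" unfolding depth_def by (intro sum.neutral) (use ends in force)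
  have nth: "(\<Sum>j<k. f (xs v ! j)) = (\<Sum>x\<in>set (xs v). f x)" if "v \<in> V" for v and f :: "nat \<Rightarrow> int"
  proof -
    have "distinct (xs v)" "length (xs v) = k" using xs[OF that] strict_sorted_iff by blast+
    then show ?thesis
      using sum_list_distinct_conv_sum_set[of "xs v" f] sum_list_sum_nth[of "map f (xs v)"]
      by (simp add: atLeast0LessThan)
  qed
  have "(\<Sum>p\<in>#chain_items k (lead v) (xs v) (ds v). g p) - (\<Sum>p\<in>#chain_preds k (lead v) K (xs v) (ds v). g p)
      = (\<Sum>x\<in>set (xs v). D x - D (x - 1)) + of_bool (v = l) * (g (0, 0) - g (K, 0))" if v: "v \<in> V" for v
  proof -
    have "(\<Sum>j<k. g (xs v ! j - 1, int (ds v ! j) - step k j)) = (\<Sum>j<k. D (xs v ! j - 1))"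
    proof (rule sum.cong)
      fix j assume "j \<in> {..<k}"
      then have j: "j < k" by simp
      have "xs v ! j \<ge> 1" using pos v j xs by simp
      then have "depth xs V (xs v ! j - 1) = depth xs V (xs v ! j) - step k j"
        using depth_step[OF fin k xs disj v j] by simp
      then show "g (xs v ! j - 1, int (ds v ! j) - step k j) = D (xs v ! j - 1)"
        using ds[OF v j] by (simp add: D_def)
    qed simp
    moreover have "(\<Sum>j<k. g (xs v ! j, int (ds v ! j))) = (\<Sum>j<k. D (xs v ! j))"
      using ds[OF v] by (simp add: D_def)
    ultimately show ?thesis
      using lead(2)[OF v] nth[OF v, of D] nth[OF v, of "\<lambda>x. D (x - 1)"]
      by (simp add: sum_chain_items sum_chain_preds sum_subtractf algebra_simps)
  qed
  then have "(\<Sum>v\<in>V. (\<Sum>p\<in>#chain_items k (lead v) (xs v) (ds v). g p)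
            - (\<Sum>p\<in>#chain_preds k (lead v) K (xs v) (ds v). g p))
      = (\<Sum>v\<in>V. \<Sum>x\<in>set (xs v). D x - D (x - 1)) + (\<Sum>v\<in>V. of_bool (v = l)) * (g (0, 0) - g (K, 0))"
    by (simp add: sum.distrib sum_distrib_right)
  also have "(\<Sum>v\<in>V. of_bool (v = l)) = (1::int)"
    using fin lead(1) by (simp add: of_bool_def)
  also have "(\<Sum>v\<in>V. \<Sum>x\<in>set (xs v). D x - D (x - 1)) = (\<Sum>x\<in>{1..K}. D x - D (x - 1))"
    unfolding un[symmetric] by (rule sum.UNION_disjoint[symmetric]) (use fin disj in auto)
  also have "\<dots> = D K - D 0"
    by (induction K) auto
  finally show ?thesis by (simp add: D_def d0 dK)
qed

end

section \<open>Random weights, certificates and aggregation\<close>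

lemma finite_bool_lists: "finite {r :: bool list. length r = l \<and> P r}"
  using finite_lists_length_eq[of "UNIV :: bool set" l] by (rule rev_finite_subset) auto

lemma card_bool_lists: "card {r :: bool list. length r = l} = 2 ^ l"
  using card_lists_length_eq[of "UNIV :: bool set" l] by simp

lemma prob_bits_not: "prob_bits l (\<lambda>r. \<not> E r) = 1 - prob_bits l E"
proof -
  have "card {r :: bool list. length r = l} =
      card {r :: bool list. length r = l \<and> E r} + card {r :: bool list. length r = l \<and> \<not> E r}"
    by (subst card_Un_disjoint[symmetric]) (auto simp: finite_bool_lists intro: arg_cong[where f = card])
  then have "real (card {r :: bool list. length r = l \<and> E r}) +
      real (card {r :: bool list. length r = l \<and> \<not> E r}) = 2 ^ l"
    by (simp add: card_bool_lists flip: of_nat_add)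
  then show ?thesis by (simp add: prob_bits_def field_simps)
qed

lemma prob_bits_mono:
  assumes "\<And>r. length r = l \<Longrightarrow> E r \<Longrightarrow> F r"
  shows "prob_bits l E \<le> prob_bits l F"
proof -
  have "card {r. length r = l \<and> E r} \<le> card {r. length r = l \<and> F r}"
    by (rule card_mono[OF finite_bool_lists]) (use assms in auto)
  then show ?thesis by (simp add: prob_bits_def divide_right_mono)
qed

lemma prob_bits_True: "prob_bits l (\<lambda>r. True) = 1"
  by (simp add: prob_bits_def card_bool_lists)

lemma prob_bits_certain:
  assumes "\<And>r. length r = l \<Longrightarrow> E r"
  shows "prob_bits l E \<ge> 1"
  using prob_bits_mono[of l "\<lambda>_. True" E] assms by (simp add: prob_bits_True)

lemma sum_mset_eq_sum_count:
  fixes g :: "'a \<Rightarrow> int"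
  assumes "finite I" "set_mset M \<subseteq> I"
  shows "(\<Sum>p\<in>#M. g p) = (\<Sum>p\<in>I. int (count M p) * g p)"
  using assms(2)
proof (induction M)
  case (add x M)
  have "(\<Sum>p\<in>I. int (count (add_mset x M) p) * g p) =
      (\<Sum>p\<in>I. int (count M p) * g p + (if p = x then g p else 0))"
    by (rule sum.cong) (auto simp: algebra_simps)
  then show ?case using add assms(1) by (simp add: sum.distrib)
qed simp

definition hash :: "bool list \<Rightarrow> ('a::countable) \<Rightarrow> int" where
  "hash r p = 2 * of_bool (r ! (2 * to_nat p)) + of_bool (r ! Suc (2 * to_nat p))"

lemma hash_bounds: "0 \<le> hash r p" "hash r p \<le> 3"
  by (auto simp: hash_def of_bool_def)

text \<open>\<open>hash\<close> addresses the bits through \<open>to_nat\<close>, so the string has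
  to reach the largest code that occurs in \<open>I\<close>.\<close>

definition hash_length :: "('a::countable) set \<Rightarrow> nat" where
  "hash_length I = 2 * Suc (Max (to_nat ` I))"

text \<open>Overwriting the two bits that determine the weight of an element with different
  multiplicities in \<open>A\<close> and \<open>B\<close> embeds four copies of the set of colliding strings into the
  set of all strings.\<close>

lemma hash_collision:
  fixes A B :: "('a::countable) multiset"
  assumes fin: "finite I" and sub: "set_mset A \<subseteq> I" "set_mset B \<subseteq> I" and "A \<noteq> B"
  shows "prob_bits (hash_length I) (\<lambda>r. (\<Sum>p\<in>#A. hash r p) = (\<Sum>p\<in>#B. hash r p)) \<le> 1/4"
proof -
  define l where "l = hash_length I"
  obtain q where q: "count A q \<noteq> count B q" using \<open>A \<noteq> B\<close> by (meson multiset_eqI)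
  then have "q \<in> I" using sub by (metis count_eq_zero_iff subsetD)
  then have "to_nat q \<le> Max (to_nat ` I)" using fin by simp
  then have l: "2 * to_nat q < l" "Suc (2 * to_nat q) < l" by (auto simp: l_def hash_length_def)
  define w where "w p = int (count A p) - int (count B p)" for p
  note sum_count = sum_mset_eq_sum_count[OF fin, where g = "hash r" for r]
  define Acc where "Acc = {r. length r = l \<and> (\<Sum>p\<in>#A. hash r p) = (\<Sum>p\<in>#B. hash r p)}"
  have Acc: "w q * hash r q + (\<Sum>p\<in>I - {q}. w p * hash r p) = 0" if "r \<in> Acc" for r
  proof -
    have "(\<Sum>p\<in>I. w p * hash r p) = 0"
      using that sum_count[OF sub(1)] sum_count[OF sub(2)]
      by (simp add: Acc_def w_def left_diff_distrib sum_subtractf)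
    then show ?thesis using fin \<open>q \<in> I\<close> by (simp add: sum.remove)
  qed
  define \<phi> where "\<phi> = (\<lambda>(r::bool list, b, c). r[2 * to_nat q := b, Suc (2 * to_nat q) := c])"
  have "inj_on \<phi> (Acc \<times> UNIV)"
  proof (rule inj_onI)
    fix x y assume xy: "x \<in> Acc \<times> UNIV" "y \<in> Acc \<times> UNIV" and eq': "\<phi> x = \<phi> y"
    obtain r b c r' b' c' where x: "x = (r, b, c)" and y: "y = (r', b', c')" by (metis prod.exhaust)
    then have r: "r \<in> Acc" "r' \<in> Acc" and eq: "\<phi> (r, b, c) = \<phi> (r', b', c')" using xy eq' by auto
    have len: "length r = l" "length r' = l" using r by (auto simp: Acc_def)
    have nth_eq: "\<phi> (r, b, c) ! i = \<phi> (r', b', c') ! i" for i using eq by simp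
    have bc: "b = b'" "c = c'"
      using nth_eq[of "2 * to_nat q"] nth_eq[of "Suc (2 * to_nat q)"] len l by (auto simp: \<phi>_def)
    have off: "r ! i = r' ! i" if "i \<noteq> 2 * to_nat q" "i \<noteq> Suc (2 * to_nat q)" for i
      using nth_eq[of i] that by (simp add: \<phi>_def)
    have "hash r p = hash r' p" if "p \<noteq> q" for p
    proof -
      have "to_nat p \<noteq> to_nat q" using that by simp
      then have "2 * to_nat p \<noteq> 2 * to_nat q" "2 * to_nat p \<noteq> Suc (2 * to_nat q)"
        "Suc (2 * to_nat p) \<noteq> 2 * to_nat q" "Suc (2 * to_nat p) \<noteq> Suc (2 * to_nat q)"
        by presburger+
      then show ?thesis using off by (simp add: hash_def)
    qed
    then have "(\<Sum>p\<in>I - {q}. w p * hash r p) = (\<Sum>p\<in>I - {q}. w p * hash r' p)"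
      by (intro sum.cong) auto
    then have "w q * hash r q = w q * hash r' q"
      using Acc[OF r(1)] Acc[OF r(2)] by linarith
    \<comment> \<open>Since \<open>w q\<close> is nonzero, a collision determines the weight of
      \<open>q\<close> from the other weights; so the two overwritten bits can be recovered.\<close>
    then have "hash r q = hash r' q" using q by (simp add: w_def)
    then have "r ! (2 * to_nat q) = r' ! (2 * to_nat q) \<and>
        r ! Suc (2 * to_nat q) = r' ! Suc (2 * to_nat q)"
      by (auto simp: hash_def of_bool_def split: if_splits)
    then have "r ! i = r' ! i" for i using off[of i] by blast
    then have "r = r'" using len by (intro nth_equalityI) auto
    with bc show "x = y" using x y by simp
  qed
  moreover have "\<phi> ` (Acc \<times> UNIV) \<subseteq> {r. length r = l}" by (auto simp: \<phi>_def Acc_def)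
  ultimately have "card (Acc \<times> (UNIV :: (bool \<times> bool) set)) \<le> card {r :: bool list. length r = l}"
    using finite_bool_lists[of l "\<lambda>_. True"] by (intro card_inj_on_le) auto
  then have "card Acc * 4 \<le> 2 ^ l"
    by (simp add: card_cartesian_product card_bool_lists flip: UNIV_Times_UNIV)
  then have "real (card Acc) * 4 \<le> 2 ^ l"
    by (metis of_nat_le_iff of_nat_mult of_nat_numeral of_nat_power)
  then show ?thesis by (simp add: prob_bits_def Acc_def l_def field_simps)
qed

section \<open>Certificates and messages as bit strings\<close>

text \<open>The decoder maps every string into \<open>S\<close>, so whatever a cheating prover sends
  is read as some well-formed certificate.\<close>

definition codec :: "'a set \<Rightarrow> nat \<Rightarrow> ('a \<Rightarrow> bool list) \<Rightarrow> (bool list \<Rightarrow> 'a) \<Rightarrow> bool" where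
  "codec S l enc dcd \<longleftrightarrow>
     (\<forall>x. length (enc x) \<le> l) \<and> (\<forall>x\<in>S. dcd (enc x) = x) \<and> (\<forall>y. dcd y \<in> S)"

lemma codec_exists:
  fixes S :: "'a set"
  assumes "finite S \<and> S \<noteq> {} \<and> card S \<le> 2 ^ l"
  shows "\<exists>enc dcd. codec S l enc dcd"
proof -
  obtain f :: "'a \<Rightarrow> bool list" where f: "f ` S \<subseteq> {r. length r = l}" "inj_on f S"
    using card_le_inj[of S "{r :: bool list. length r = l}"] assms finite_bool_lists[of l "\<lambda>_. True"]
    by (auto simp: card_bool_lists)
  obtain s where "s \<in> S" using assms by blast
  define enc where "enc x = (if x \<in> S then f x else [])" for x
  define dcd where "dcd y = (if y \<in> f ` S then inv_into S f y else s)" for y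
  have "length (enc x) \<le> l" for x using f by (auto simp: enc_def)
  moreover have "dcd (enc x) = x" if "x \<in> S" for x using that f by (simp add: enc_def dcd_def)
  moreover have "dcd y \<in> S" for y using \<open>s \<in> S\<close> by (auto simp: dcd_def inv_into_into)
  ultimately show ?thesis unfolding codec_def by blast
qed

definition network :: "nat \<Rightarrow> nat set \<Rightarrow> (nat \<Rightarrow> nat \<Rightarrow> bool) \<Rightarrow> (nat \<Rightarrow> nat) \<Rightarrow> nat \<Rightarrow> bool" where
  "network d V Adj ident N \<longleftrightarrow>
     simple_connected_graph V Adj \<and> inj_on ident V \<and>
     (\<forall>v\<in>V. 1 \<le> ident v \<and> ident v \<le> card V ^ d) \<and> card V \<le> N \<and> N \<le> card V ^ d"

text \<open>Separates the protocol from its encoding: certificates and messages may be elements of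
  finite sets of size at most \<open>2 ^ q N\<close>. In \<open>sound\<close> the second
  certificates are chosen inside the event, since Merlin knows \<open>r\<close>, while the first are
  fixed outside. Passing from the upper bound \<open>N\<close> to the number of nodes costs a factor
  \<open>d\<close> in the length.\<close>

lemma dMAM_logI:
  fixes C1 :: "nat \<Rightarrow> 'a set" and C2 :: "nat \<Rightarrow> 'b set" and M :: "nat \<Rightarrow> 'm set"
    and msg :: "nat \<Rightarrow> 'a \<Rightarrow> 'b \<Rightarrow> 'm"
    and dec :: "nat \<Rightarrow> nat \<Rightarrow> 'a \<Rightarrow> 'b \<Rightarrow> bool list \<Rightarrow> 'm multiset \<Rightarrow> bool"
  assumes d: "d \<ge> 1"
    and C1: "\<And>N. finite (C1 N) \<and> C1 N \<noteq> {} \<and> card (C1 N) \<le> 2 ^ q N"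
    and C2: "\<And>N. finite (C2 N) \<and> C2 N \<noteq> {} \<and> card (C2 N) \<le> 2 ^ q N"
    and M: "\<And>N. finite (M N) \<and> M N \<noteq> {} \<and> card (M N) \<le> 2 ^ q N"
    and q: "c \<ge> 0" "\<And>N. real (q N) \<le> c * (1 + log 2 (real N))"
    and msg: "\<And>N i a b. i \<le> N ^ d \<Longrightarrow> a \<in> C1 N \<Longrightarrow> b \<in> C2 N \<Longrightarrow> msg i a b \<in> M N"
    and complete: "\<And>V Adj ident N. network d V Adj ident N \<Longrightarrow> Cls V Adj \<Longrightarrow>
       \<exists>c1. (\<forall>v\<in>V. c1 v \<in> C1 N) \<and> (\<forall>r. \<exists>c2. (\<forall>v\<in>V. c2 v \<in> C2 N) \<and>
         (\<forall>v\<in>V. dec N (ident v) (c1 v) (c2 v) r (received Adj V (\<lambda>u. msg (ident u) (c1 u) (c2 u)) v)))"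
    and sound: "\<And>V Adj ident N c1. network d V Adj ident N \<Longrightarrow> \<not> Cls V Adj \<Longrightarrow> (\<And>v. c1 v \<in> C1 N) \<Longrightarrow>
       prob_bits (L N) (\<lambda>r. \<exists>c2. (\<forall>v. c2 v \<in> C2 N) \<and>
         (\<forall>v\<in>V. dec N (ident v) (c1 v) (c2 v) r (received Adj V (\<lambda>u. msg (ident u) (c1 u) (c2 u)) v))) \<le> 1/3"
  shows "dMAM_log d Cls"
proof -
  obtain e1 d1 where "\<And>N. codec (C1 N) (q N) (e1 N) (d1 N)"
    using codec_exists[OF C1] by metis
  then have 1: "length (e1 N x) \<le> q N" "x \<in> C1 N \<Longrightarrow> d1 N (e1 N x) = x" "d1 N y \<in> C1 N" for N x y
    unfolding codec_def by blast+
  obtain e2 d2 where "\<And>N. codec (C2 N) (q N) (e2 N) (d2 N)"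
    using codec_exists[OF C2] by metis
  then have 2: "length (e2 N x) \<le> q N" "x \<in> C2 N \<Longrightarrow> d2 N (e2 N x) = x" "d2 N y \<in> C2 N" for N x y
    unfolding codec_def by blast+
  obtain e3 d3 where "\<And>N. codec (M N) (q N) (e3 N) (d3 N)"
    using codec_exists[OF M] by metis
  then have 3: "length (e3 N x) \<le> q N" "x \<in> M N \<Longrightarrow> d3 N (e3 N x) = x" "d3 N y \<in> M N" for N x y
    unfolding codec_def by blast+
  define bmsg where "bmsg N i a b r = e3 N (msg i (d1 N a) (d2 N b))" for N i a b and r :: "bool list"
  define bdec where "bdec N i a b r X = dec N i (d1 N a) (d2 N b) r (image_mset (d3 N) X)" for N i a b r X
  \<comment> \<open>The message bound is required for all \<open>N\<close>; at 0 the logarithm has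
    the default value 0.\<close>
  have log_nonneg: "0 \<le> log 2 (real m)" for m by (cases "m = 0") (auto simp: log_def)
  have len_msg: "real (length (bmsg N i a b r)) \<le> c * d * (1 + log 2 (real N))" for N i a b r
  proof -
    have "real (length (bmsg N i a b r)) \<le> q N" using 3(1) by (simp add: bmsg_def)
    also have "\<dots> \<le> c * 1 * (1 + log 2 (real N))" using q by simp
    also have "\<dots> \<le> c * d * (1 + log 2 (real N))"
      using q(1) d log_nonneg[of N] by (intro mult_right_mono mult_left_mono) auto
    finally show ?thesis .
  qed
  have len: "real (q N) \<le> c * d * (1 + log 2 (real (card V)))" if "network d V Adj ident N" for V Adj ident N
  proof -
    have "V \<noteq> {}" "finite V" "card V \<le> N" "N \<le> card V ^ d"
      using that by (auto simp: network_def simple_connected_graph_def)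
    then have "card V > 0" "N > 0" by (auto simp: card_gt_0_iff)
    then have "log 2 (real N) \<le> log 2 (real (card V) ^ d)"
      using \<open>N \<le> card V ^ d\<close> by (simp flip: of_nat_power)
    also have "\<dots> = d * log 2 (real (card V))" using \<open>card V > 0\<close> by (simp add: log_nat_power)
    finally have "1 + log 2 (real N) \<le> d * (1 + log 2 (real (card V)))" using d by (simp add: algebra_simps)
    then have "c * (1 + log 2 (real N)) \<le> c * (d * (1 + log 2 (real (card V))))"
      using q(1) by (rule mult_left_mono)
    then show ?thesis using q(2)[of N] by (simp add: mult.assoc)
  qed
  have acc: "all_accept bmsg bdec N V Adj ident c1 c2 r \<longleftrightarrow>
      (\<forall>v\<in>V. dec N (ident v) (d1 N (c1 v)) (d2 N (c2 v)) r
         (received Adj V (\<lambda>u. msg (ident u) (d1 N (c1 u)) (d2 N (c2 u))) v))"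
    if net: "network d V Adj ident N" for N V Adj ident c1 c2 r
  proof -
    have "image_mset (d3 N) (received Adj V (\<lambda>u. bmsg N (ident u) (c1 u) (c2 u) r) v) =
        received Adj V (\<lambda>u. msg (ident u) (d1 N (c1 u)) (d2 N (c2 u))) v" for v
      unfolding received_def image_mset.compositionality
    proof (rule image_mset_cong)
      fix u assume u: "u \<in># mset_set {u \<in> V. Adj v u}"
      have "finite V" using net by (auto simp: network_def simple_connected_graph_def)
      then have "u \<in> V" using u by simp
      then have "ident u \<le> card V ^ d" "card V \<le> N" using net by (auto simp: network_def)
      then have "ident u \<le> N ^ d" using power_mono[of "card V" N d] by simp
      then show "(d3 N \<circ> (\<lambda>u. bmsg N (ident u) (c1 u) (c2 u) r)) u = msg (ident u) (d1 N (c1 u)) (d2 N (c2 u))"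
        by (simp add: bmsg_def 3(2) msg 1(3) 2(3))
    qed
    then show ?thesis by (simp add: all_accept_def bdec_def)
  qed
  show ?thesis
    unfolding dMAM_log_def
  proof (intro exI[of _ "c * d"] exI[of _ L] exI[of _ bmsg] exI[of _ bdec] conjI allI impI)
    show "real (length (bmsg N i a b r)) \<le> c * d * (1 + log 2 (real N))" for N i a b r by (rule len_msg)
  next
    fix V Adj and ident :: "nat \<Rightarrow> nat" and N
    assume "simple_connected_graph V Adj" "inj_on ident V" "\<forall>v\<in>V. 1 \<le> ident v \<and> ident v \<le> card V ^ d"
      "card V \<le> N" "N \<le> card V ^ d"
    then have net: "network d V Adj ident N" by (simp add: network_def)
    { assume "Cls V Adj"
      from complete[OF net this] obtain c1 where c1: "\<forall>v\<in>V. c1 v \<in> C1 N"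
        and "\<forall>r. \<exists>c2. (\<forall>v\<in>V. c2 v \<in> C2 N) \<and> (\<forall>v\<in>V. dec N (ident v) (c1 v) (c2 v) r
              (received Adj V (\<lambda>u. msg (ident u) (c1 u) (c2 u)) v))" by blast
      then obtain c2 where c2: "\<And>r. \<forall>v\<in>V. c2 r v \<in> C2 N" and ok: "\<And>r. \<forall>v\<in>V. dec N (ident v) (c1 v) (c2 r v) r
              (received Adj V (\<lambda>u. msg (ident u) (c1 u) (c2 r u)) v)" by metis
      have "all_accept bmsg bdec N V Adj ident (\<lambda>v. e1 N (c1 v)) (\<lambda>v. e2 N (c2 r v)) r" for r
      proof -
        have "received Adj V (\<lambda>u. msg (ident u) (d1 N (e1 N (c1 u))) (d2 N (e2 N (c2 r u)))) v =
              received Adj V (\<lambda>u. msg (ident u) (c1 u) (c2 r u)) v" for v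
          unfolding received_def
        proof (rule image_mset_cong)
          fix u assume u: "u \<in># mset_set {u \<in> V. Adj v u}"
          have "finite V" using net by (auto simp: network_def simple_connected_graph_def)
          then have "u \<in> V" using u by simp
          then show "msg (ident u) (d1 N (e1 N (c1 u))) (d2 N (e2 N (c2 r u))) = msg (ident u) (c1 u) (c2 r u)"
            using c1 c2 1(2) 2(2) by simp
        qed
        then show ?thesis using ok c1 c2 1(2) 2(2) by (simp add: acc[OF net])
      qed
      then have "1 \<le> prob_bits (L N) (\<lambda>r. all_accept bmsg bdec N V Adj ident (\<lambda>v. e1 N (c1 v)) (\<lambda>v. e2 N (c2 r v)) r)"
        by (intro prob_bits_certain)
      then have "2/3 \<le> prob_bits (L N) (\<lambda>r. all_accept bmsg bdec N V Adj ident (\<lambda>v. e1 N (c1 v)) (\<lambda>v. e2 N (c2 r v)) r)"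
        by linarith
      moreover have "real (length (e1 N x)) \<le> c * d * (1 + log 2 (real (card V)))"
        "real (length (e2 N y)) \<le> c * d * (1 + log 2 (real (card V)))" for x y
        using len[OF net] 1(1)[of N x] 2(1)[of N y] by linarith+
      ultimately show "\<exists>c1 c2. (\<forall>v\<in>V. real (length (c1 v)) \<le> c * d * (1 + log 2 (real (card V)))) \<and>
         (\<forall>r. \<forall>v\<in>V. real (length (c2 r v)) \<le> c * d * (1 + log 2 (real (card V)))) \<and>
         2/3 \<le> prob_bits (L N) (\<lambda>r. all_accept bmsg bdec N V Adj ident c1 (c2 r) r)"
        by (intro exI[of _ "\<lambda>v. e1 N (c1 v)"] exI[of _ "\<lambda>r v. e2 N (c2 r v)"]) simp }
    { fix c1 :: "nat \<Rightarrow> bool list" and c2 :: "bool list \<Rightarrow> nat \<Rightarrow> bool list"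
      assume "\<not> Cls V Adj"
      have "prob_bits (L N) (\<lambda>r. all_accept bmsg bdec N V Adj ident c1 (c2 r) r) \<le>
        prob_bits (L N) (\<lambda>r. \<exists>b. (\<forall>v. b v \<in> C2 N) \<and> (\<forall>v\<in>V. dec N (ident v) (d1 N (c1 v)) (b v) r
           (received Adj V (\<lambda>u. msg (ident u) (d1 N (c1 u)) (b u)) v)))"
      proof (rule prob_bits_mono)
        fix r assume "all_accept bmsg bdec N V Adj ident c1 (c2 r) r"
        then show "\<exists>b. (\<forall>v. b v \<in> C2 N) \<and> (\<forall>v\<in>V. dec N (ident v) (d1 N (c1 v)) (b v) r
           (received Adj V (\<lambda>u. msg (ident u) (d1 N (c1 u)) (b u)) v))"
          using 2(3) by (intro exI[of _ "\<lambda>v. d2 N (c2 r v)"]) (simp add: acc[OF net])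
      qed
      also have "\<dots> \<le> 1/3" by (rule sound[OF net \<open>\<not> Cls V Adj\<close> 1(3)])
      finally show "2/3 \<le> prob_bits (L N) (\<lambda>r. \<not> all_accept bmsg bdec N V Adj ident c1 (c2 r) r)"
        by (simp add: prob_bits_not) }
  qed
qed

text \<open>Summing the local equations over all nodes, every value except those of the roots cancels.
  This holds for arbitrary parent pointers, also if they form cycles.\<close>

lemma aggregation_sound:
  fixes f s :: "nat \<Rightarrow> int"
  assumes fin: "finite V" and inj: "inj_on ident V" and sym: "\<And>u v. Adj u v \<Longrightarrow> Adj v u"
    and eq: "\<And>v. v \<in> V \<Longrightarrow> s v = f v + (\<Sum>u | u \<in> V \<and> Adj v u \<and> par u = ident v. s u)"
    and root: "\<And>v. v \<in> V \<Longrightarrow> s v = 0 \<or> (\<exists>u\<in>V. Adj v u \<and> ident u = par v)"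
  shows "(\<Sum>v\<in>V. f v) = 0"
proof -
  have "(\<Sum>v\<in>V. s v) = (\<Sum>v\<in>V. f v) + (\<Sum>v\<in>V. \<Sum>u | u \<in> V \<and> Adj v u \<and> par u = ident v. s u)"
    by (simp add: eq sum.distrib cong: sum.cong)
  also have "(\<Sum>v\<in>V. \<Sum>u | u \<in> V \<and> Adj v u \<and> par u = ident v. s u) =
      (\<Sum>v\<in>V. \<Sum>u\<in>V. if Adj v u \<and> par u = ident v then s u else 0)"
    by (rule sum.cong[OF refl]) (simp add: sum.inter_filter[OF fin])
  also have "\<dots> = (\<Sum>u\<in>V. \<Sum>v\<in>V. if Adj v u \<and> par u = ident v then s u else 0)"
    by (rule sum.swap)
  also have "\<dots> = (\<Sum>u\<in>V. s u)"
  proof (rule sum.cong)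
    fix u assume u: "u \<in> V"
    show "(\<Sum>v\<in>V. if Adj v u \<and> par u = ident v then s u else 0) = s u"
    proof (cases "s u = 0")
      case False
      \<comment> \<open>Distinct identifiers make \<open>w\<close> the only node that adds
        \<open>s u\<close>.\<close>
      then obtain w where w: "w \<in> V" "Adj u w" "ident w = par u" using root[OF u] by blast
      have "(\<Sum>v\<in>V. if Adj v u \<and> par u = ident v then s u else 0) = (\<Sum>v\<in>V. if v = w then s u else 0)"
        by (rule sum.cong) (use w inj sym in \<open>auto simp: inj_on_def\<close>)
      then show ?thesis using fin w by simp
    next
      case True
      then show ?thesis by (simp only: if_cancel sum.neutral_const)
    qed
  qed simp
  finally show ?thesis by simp
qed

text \<open>Supplies the edge by which a growing tree gets its next leaf.\<close>

lemma connected_boundary_edge: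
  assumes "simple_connected_graph V Adj" "W \<subseteq> V" "W \<noteq> {}" "W \<noteq> V"
  shows "\<exists>p\<in>W. \<exists>w\<in>V - W. Adj p w"
proof -
  obtain x y where x: "x \<in> W" and y: "y \<in> V" "y \<notin> W" using assms by blast
  have "Adj\<^sup>*\<^sup>* x y" using assms x y unfolding simple_connected_graph_def by blast
  then show ?thesis using y(2)
  proof (induction rule: rtranclp_induct)
    case base
    then show ?case using x by blast
  next
    case (step b c)
    have "c \<in> V" using assms(1) step(2) unfolding simple_connected_graph_def by blast
    then show ?case using step by blast
  qed
qed

text \<open>The parent pointers form a spanning tree grown one leaf at a time, and \<open>s\<close>
  sums \<open>f\<close> over subtrees. They have to serve all \<open>f\<close> at once because they
  are committed before the random string is known. The bound on \<open>s\<close> keeps the second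
  certificates short.\<close>

lemma aggregation_complete:
  assumes gr: "simple_connected_graph V Adj" and t: "t \<in> V"
  shows "\<exists>par. par t = t \<and> (\<forall>v\<in>V - {t}. par v \<in> V \<and> Adj v (par v)) \<and>
    (\<forall>f :: nat \<Rightarrow> int. (\<Sum>v\<in>V. f v) = 0 \<longrightarrow> (\<exists>s. s t = 0 \<and>
       (\<forall>v\<in>V. s v = f v + (\<Sum>u | u \<in> V \<and> Adj v u \<and> par u = v. s u) \<and> \<bar>s v\<bar> \<le> (\<Sum>v\<in>V. \<bar>f v\<bar>))))"
    (is "\<exists>par. ?P V par")
proof -
  have fin: "finite V" and sym: "\<And>u v. Adj u v \<Longrightarrow> Adj v u" and irr: "\<And>u. \<not> Adj u u"
    using gr unfolding simple_connected_graph_def by blast+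
  have grow: "\<exists>W par. W \<subseteq> V \<and> t \<in> W \<and> card W = Suc m \<and> ?P W par" if "m < card V" for m
    using that
  proof (induction m)
    case 0
    \<comment> \<open>The root is its own parent but not its own neighbour, so its value is not
      added to itself.\<close>
    have "?P {t} (\<lambda>_. t)"
      using irr by (auto intro!: exI[of _ "\<lambda>_. 0 :: int"])
    then show ?case using t by (intro exI[of _ "{t}"] exI[of _ "\<lambda>_. t"]) simp
  next
    case (Suc m)
    then obtain W par where W: "W \<subseteq> V" "t \<in> W" "card W = Suc m" and P: "?P W par" by auto
    have "W \<noteq> V" using W Suc.prems by auto
    then obtain p w where p: "p \<in> W" and w: "w \<in> V" "w \<notin> W" and pw: "Adj p w"
      using connected_boundary_edge[OF gr W(1)] W(2) by blast
    have finW: "finite W" using W(1) fin by (rule finite_subset)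
    have parW: "par v \<in> W" if "v \<in> W" for v using P that W(2) by (cases "v = t") auto
    define par' where "par' = par(w := p)"
    have "?P (insert w W) par'"
    proof (intro conjI allI impI ballI)
      show "par' t = t" using P W(2) w by (auto simp: par'_def)
      show "par' v \<in> insert w W" "Adj v (par' v)" if "v \<in> insert w W - {t}" for v
        using that P p pw sym by (auto simp: par'_def)
    next
      fix f :: "nat \<Rightarrow> int" assume f: "(\<Sum>v\<in>insert w W. f v) = 0"
      \<comment> \<open>The new leaf \<open>w\<close> hands its value to its parent
        \<open>p\<close>; by the triangle inequality this does not increase the sum of absolute
        values.\<close>
      define f' where "f' = f(p := f p + f w)"
      have sum_p: "(\<Sum>v\<in>W. g v) = g p + (\<Sum>v\<in>W - {p}. g v)" for g :: "nat \<Rightarrow> int"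
        using finW p by (simp add: sum.remove)
      have rest: "(\<Sum>v\<in>W - {p}. h (f' v)) = (\<Sum>v\<in>W - {p}. h (f v))" for h :: "int \<Rightarrow> int"
        by (rule sum.cong) (auto simp: f'_def)
      have "(\<Sum>v\<in>W. f' v) = 0"
        using f sum_p[of f'] sum_p[of f] rest[of "\<lambda>x. x"] finW w by (simp add: f'_def)
      then obtain s where s: "s t = 0"
        "\<And>v. v \<in> W \<Longrightarrow> s v = f' v + (\<Sum>u | u \<in> W \<and> Adj v u \<and> par u = v. s u)"
        "\<And>v. v \<in> W \<Longrightarrow> \<bar>s v\<bar> \<le> (\<Sum>v\<in>W. \<bar>f' v\<bar>)"
        using P by blast
      have abs_le: "(\<Sum>v\<in>W. \<bar>f' v\<bar>) \<le> (\<Sum>v\<in>insert w W. \<bar>f v\<bar>)"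
        using sum_p[of "\<lambda>v. \<bar>f' v\<bar>"] sum_p[of "\<lambda>v. \<bar>f v\<bar>"] rest[of abs] finW w by (simp add: f'_def)
      define s' where "s' = s(w := f w)"
      have "s' v = f v + (\<Sum>u | u \<in> insert w W \<and> Adj v u \<and> par' u = v. s' u) \<and> \<bar>s' v\<bar> \<le> (\<Sum>v\<in>insert w W. \<bar>f v\<bar>)"
        if v: "v \<in> insert w W" for v
      proof (cases "v = w")
        case True
        have "{u. u \<in> insert w W \<and> Adj w u \<and> par' u = w} = {}"
          using parW w irr by (auto simp: par'_def)
        then have "(\<Sum>u | u \<in> insert w W \<and> Adj w u \<and> par' u = w. s' u) = 0" by (simp only: sum.empty)
        moreover have "\<bar>f w\<bar> \<le> (\<Sum>v\<in>insert w W. \<bar>f v\<bar>)"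
          by (rule member_le_sum) (use finW in auto)
        moreover have "s' w = f w" by (simp add: s'_def)
        ultimately show ?thesis unfolding True by (intro conjI) linarith+
      next
        case False
        then have vW: "v \<in> W" using v by simp
        have bound: "\<bar>s' v\<bar> \<le> (\<Sum>v\<in>insert w W. \<bar>f v\<bar>)"
          using s(3)[OF vW] abs_le False by (simp add: s'_def)
        let ?C = "{u. u \<in> W \<and> Adj v u \<and> par u = v}"
        have old: "(\<Sum>u\<in>?C. s' u) = (\<Sum>u\<in>?C. s u)"
          by (rule sum.cong) (use w in \<open>auto simp: s'_def\<close>)
        show ?thesis
        proof (cases "v = p")
          case True
          have "{u. u \<in> insert w W \<and> Adj v u \<and> par' u = v} = insert w ?C"
            using w True pw by (auto simp: par'_def)
          then have "(\<Sum>u | u \<in> insert w W \<and> Adj v u \<and> par' u = v. s' u) = f w + (\<Sum>u\<in>?C. s' u)"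
            using w finW by (simp add: s'_def)
          then show ?thesis using bound old s(2)[OF vW] True False by (simp add: s'_def f'_def)
        next
          case False2: False
          have "{u. u \<in> insert w W \<and> Adj v u \<and> par' u = v} = ?C"
            using w False2 by (auto simp: par'_def)
          then show ?thesis using bound old s(2)[OF vW] False False2 by (simp add: s'_def f'_def)
        qed
      qed
      moreover have "s' t = 0" using s(1) w W(2) by (auto simp: s'_def)
      ultimately show "\<exists>s. s t = 0 \<and> (\<forall>v\<in>insert w W. s v = f v + (\<Sum>u | u \<in> insert w W \<and> Adj v u \<and> par' u = v. s u)
          \<and> \<bar>s v\<bar> \<le> (\<Sum>v\<in>insert w W. \<bar>f v\<bar>))" by blast
    qed
    moreover have "card (insert w W) = Suc (Suc m)" using W w finW by simp
    ultimately show ?case using W w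
      by (intro exI[of _ "insert w W"] exI[of _ par']) simp
  qed
  have "card V > 0" using t fin by (auto simp: card_gt_0_iff)
  then have "card V - 1 < card V" by simp
  from grow[OF this] obtain W par where W: "W \<subseteq> V \<and> t \<in> W \<and> card W = Suc (card V - 1) \<and> ?P W par"
    by (elim exE)
  then have "W = V" using \<open>card V > 0\<close> fin by (intro card_subset_eq) auto
  then show ?thesis using W by (intro exI[where x = par]) simp
qed

section \<open>The protocol\<close>

text \<open>\<open>depths\<close> claims, for each vertex of the node, how many polygons have started but not ended
  when the circle is scanned up to and including that vertex; \<open>final\<close> claims the last position of
  the circle and only matters at the leader.\<close>

datatype cert =
  Cert (leader: nat) (parent: nat) (final: nat) (positions: "nat list") (depths: "nat list")

datatype message =
  Message (sender: nat) (msg_leader: nat) (msg_parent: nat) (msg_positions: "nat list") (msg_value: int)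

section \<open>Sizes of the certificate and message spaces\<close>

definition nat_lists :: "nat \<Rightarrow> nat \<Rightarrow> nat list set" where
  "nat_lists k B = {xs. set xs \<subseteq> {..<B} \<and> length xs = k}"

definition certs :: "nat \<Rightarrow> nat \<Rightarrow> cert set" where
  "certs k B = (\<lambda>(l, p, e, xs, ds). Cert l p e xs ds) `
     ({..<B} \<times> {..<B} \<times> {..<B} \<times> nat_lists k B \<times> nat_lists k B)"

definition messages :: "nat \<Rightarrow> nat \<Rightarrow> message set" where
  "messages k B = (\<lambda>(i, l, p, xs, s). Message i l p xs s) `
     ({..<B} \<times> {..<B} \<times> {..<B} \<times> nat_lists k B \<times> {- int B..<int B})"

lemma finite_nat_lists: "finite (nat_lists k B)"
  unfolding nat_lists_def by (rule finite_lists_length_eq) simp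

lemma card_nat_lists: "card (nat_lists k B) = B ^ k"
  unfolding nat_lists_def by (subst card_lists_length_eq) simp_all

lemma certs_iff:
  "c \<in> certs k B \<longleftrightarrow> leader c < B \<and> parent c < B \<and> final c < B \<and> positions c \<in> nat_lists k B \<and> depths c \<in> nat_lists k B"
  by (cases c) (auto simp: certs_def image_iff)

lemma messages_iff:
  "m \<in> messages k B \<longleftrightarrow> sender m < B \<and> msg_leader m < B \<and> msg_parent m < B \<and>
     msg_positions m \<in> nat_lists k B \<and> msg_value m \<in> {- int B..<int B}"
  by (cases m) (auto simp: messages_def image_iff)

text \<open>The exponent is a common bound for all three spaces: certificates take
  \<open>(2 * k + 3) * w\<close> bits, messages \<open>(k + 4) * w + 1\<close> and values
  \<open>w + 1\<close>, the extra bit being the sign.\<close>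

lemma certs_size:
  assumes "B = 2 ^ w"
  shows "finite (certs k B) \<and> certs k B \<noteq> {} \<and> card (certs k B) \<le> 2 ^ ((2 * k + 4) * Suc w)"
proof (intro conjI)
  let ?D = "{..<B} \<times> {..<B} \<times> {..<B} \<times> nat_lists k B \<times> nat_lists k B"
  have fin: "finite ?D" by (simp add: finite_nat_lists)
  then show "finite (certs k B)" unfolding certs_def by (rule finite_imageI)
  have "Cert 0 0 0 (replicate k 0) (replicate k 0) \<in> certs k B"
    using assms by (auto simp: certs_iff nat_lists_def)
  then show "certs k B \<noteq> {}" by blast
  have "card (certs k B) \<le> card ?D" unfolding certs_def by (rule card_image_le[OF fin])
  also have "\<dots> = 2 ^ (w * (2 * k + 3))"
    by (simp add: card_cartesian_product card_nat_lists assms algebra_simps flip: power_mult power_add)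
  also have "\<dots> \<le> 2 ^ ((2 * k + 4) * Suc w)"
    by (rule power_increasing) (auto simp: algebra_simps)
  finally show "card (certs k B) \<le> 2 ^ ((2 * k + 4) * Suc w)" .
qed

lemma card_values: "card {- int B..<int B} = 2 * B"
  unfolding card_atLeastLessThan_int by linarith

lemma values_size:
  assumes "B = 2 ^ w"
  shows "finite {- int B..<int B} \<and> {- int B..<int B} \<noteq> {} \<and> card {- int B..<int B} \<le> 2 ^ ((2 * k + 4) * Suc w)"
proof -
  have "card {- int B..<int B} = 2 ^ Suc w" unfolding card_values by (simp add: assms)
  also have "\<dots> \<le> 2 ^ ((2 * k + 4) * Suc w)"
    by (rule power_increasing) (auto simp: algebra_simps)
  finally show ?thesis using assms by simp
qed

lemma messages_size:
  assumes "B = 2 ^ w"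
  shows "finite (messages k B) \<and> messages k B \<noteq> {} \<and> card (messages k B) \<le> 2 ^ ((2 * k + 4) * Suc w)"
proof (intro conjI)
  let ?D = "{..<B} \<times> {..<B} \<times> {..<B} \<times> nat_lists k B \<times> {- int B..<int B}"
  have fin: "finite ?D" by (simp add: finite_nat_lists)
  then show "finite (messages k B)" unfolding messages_def by (rule finite_imageI)
  have "Message 0 0 0 (replicate k 0) 0 \<in> messages k B"
    using assms by (auto simp: messages_iff nat_lists_def)
  then show "messages k B \<noteq> {}" by blast
  have "card (messages k B) \<le> card ?D" unfolding messages_def by (rule card_image_le[OF fin])
  also have "\<dots> = B * (B * (B * (B ^ k * (2 * B))))"
    by (simp only: card_cartesian_product card_nat_lists card_values card_lessThan)
  also have "\<dots> = 2 ^ Suc (w * (k + 4))"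
    by (simp add: assms algebra_simps flip: power_mult power_add)
  also have "\<dots> \<le> 2 ^ ((2 * k + 4) * Suc w)"
    by (rule power_increasing) (auto simp: algebra_simps)
  finally show "card (messages k B) \<le> 2 ^ ((2 * k + 4) * Suc w)" .
qed

text \<open>\<open>2 ^ width k d N\<close> has to exceed every number sent by the honest prover:
  identifiers up to \<open>N ^ d\<close>, positions up to k n, depths up to n and values up to 3 (k
  + 1) n in absolute value, all at most \<open>8 * (k + 1) * N ^ d\<close>. The constant factor may
  simply enter the exponent since \<open>m < 2 ^ m\<close>.\<close>

definition width :: "nat \<Rightarrow> nat \<Rightarrow> nat \<Rightarrow> nat" where
  "width k d N = d * nat \<lceil>log 2 (real N)\<rceil> + 8 * (k + 1)"

lemma less_two_power_width:
  assumes "e \<le> 8 * (k + 1) * N ^ d"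
  shows "e < 2 ^ width k d N"
proof -
  define t where "t = nat \<lceil>log 2 (real N)\<rceil>"
  have "N \<le> 2 ^ t"
  proof (cases "N = 0")
    case False
    then have "real N = 2 powr (log 2 (real N))" by simp
    also have "\<dots> \<le> 2 powr (real t)" unfolding t_def by (intro powr_mono) linarith+
    finally have "real N \<le> real (2 ^ t)" by (simp add: powr_realpow)
    then show ?thesis by (simp only: of_nat_le_iff)
  qed simp
  then have "N ^ d \<le> 2 ^ (d * t)" using power_mono[of N "2 ^ t" d] by (simp add: mult.commute flip: power_mult)
  then have "e \<le> 8 * (k + 1) * 2 ^ (d * t)" using assms by (meson le_trans mult_le_mono2)
  also have "\<dots> < 2 ^ (8 * (k + 1)) * 2 ^ (d * t)"
    by (rule mult_strict_right_mono[OF less_exp]) simp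
  finally show ?thesis by (simp add: width_def t_def power_add mult.commute)
qed

lemma width_log_bound:
  "real ((2 * k + 4) * Suc (width k d N)) \<le> real ((2 * k + 4) * (d + 8 * k + 9)) * (1 + log 2 (real N))"
proof -
  have nonneg: "0 \<le> log 2 (real N)" by (cases "N = 0") (auto simp: log_def)
  have "real (nat \<lceil>log 2 (real N)\<rceil>) \<le> 1 + log 2 (real N)" using nonneg by linarith
  then have "real d * real (nat \<lceil>log 2 (real N)\<rceil>) \<le> real d * (1 + log 2 (real N))"
    by (rule mult_left_mono) simp
  moreover have "real (8 * k + 9) * 1 \<le> real (8 * k + 9) * (1 + log 2 (real N))"
    by (rule mult_left_mono) (use nonneg in auto)
  ultimately have "real (Suc (width k d N)) \<le> real (d + 8 * k + 9) * (1 + log 2 (real N))"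
    by (simp add: width_def distrib_right)
  then have "real (2 * k + 4) * real (Suc (width k d N)) \<le> real (2 * k + 4) * (real (d + 8 * k + 9) * (1 + log 2 (real N)))"
    by (rule mult_left_mono) simp
  then show ?thesis by (simp only: of_nat_mult mult.assoc)
qed

section \<open>The verifier\<close>

definition send :: "nat \<Rightarrow> cert \<Rightarrow> int \<Rightarrow> message" where
  "send i c s = Message i (leader c) (parent c) (positions c) s"

definition local_sum :: "nat \<Rightarrow> nat \<Rightarrow> cert \<Rightarrow> bool list \<Rightarrow> int" where
  "local_sum k i c r = (\<Sum>p\<in>#chain_items k (leader c = i) (positions c) (depths c). hash r p)
     - (\<Sum>p\<in>#chain_preds k (leader c = i) (final c) (positions c) (depths c). hash r p)"

text \<open>The left side of the gap condition is the claimed depth just before the next vertex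
  minus that at the present one. For true depths it is the balance of all polygons in the gap, and
  equality leaves 0 for the non-neighbours. The leader's aggregate must vanish, and every other node
  must have a neighbour as parent, so that no value is lost.\<close>

definition accepts :: "nat \<Rightarrow> nat \<Rightarrow> cert \<Rightarrow> int \<Rightarrow> bool list \<Rightarrow> message multiset \<Rightarrow> bool" where
  "accepts k i c s r X \<longleftrightarrow>
     sorted_wrt (<) (positions c) \<and> (\<forall>x\<in>set (positions c). 1 \<le> x) \<and>
     (\<forall>m\<in>#X. msg_leader m = leader c \<and> interleaved (set (positions c)) (set (msg_positions m))) \<and>
     (\<forall>j. Suc j < k \<longrightarrow> int (depths c ! Suc j) - step k (Suc j) - int (depths c ! j) =
        (\<Sum>m\<in>#X. gap_balance (msg_positions m) (positions c ! j) (positions c ! Suc j))) \<and>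
     s = local_sum k i c r + (\<Sum>m\<in>#X. if msg_parent m = i then msg_value m else 0) \<and>
     (if leader c = i then s = 0 else \<exists>m\<in>#X. sender m = parent c)"

lemma accepts_received:
  assumes "finite V"
  shows "accepts k i c s r (received Adj V (\<lambda>u. send (ident u) (c1 u) (c2 u)) v) \<longleftrightarrow>
     sorted_wrt (<) (positions c) \<and> (\<forall>x\<in>set (positions c). 1 \<le> x) \<and>
     (\<forall>u\<in>V. Adj v u \<longrightarrow> leader (c1 u) = leader c \<and> interleaved (set (positions c)) (set (positions (c1 u)))) \<and>
     (\<forall>j. Suc j < k \<longrightarrow> int (depths c ! Suc j) - step k (Suc j) - int (depths c ! j) =
        (\<Sum>u | u \<in> V \<and> Adj v u. gap_balance (positions (c1 u)) (positions c ! j) (positions c ! Suc j))) \<and>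
     s = local_sum k i c r + (\<Sum>u | u \<in> V \<and> Adj v u \<and> parent (c1 u) = i. c2 u) \<and>
     (if leader c = i then s = 0 else \<exists>u\<in>V. Adj v u \<and> ident u = parent c)"
proof -
  let ?X = "received Adj V (\<lambda>u. send (ident u) (c1 u) (c2 u)) v"
  have fin: "finite {u \<in> V. Adj v u}" using assms by simp
  have sum: "(\<Sum>m\<in>#?X. g m) = (\<Sum>u | u \<in> V \<and> Adj v u. g (send (ident u) (c1 u) (c2 u)))" for g :: "message \<Rightarrow> int"
    by (simp add: received_def sum_unfold_sum_mset image_mset.compositionality comp_def)
  have mem: "m \<in># ?X \<longleftrightarrow> (\<exists>u\<in>V. Adj v u \<and> m = send (ident u) (c1 u) (c2 u))" for m
    using fin by (auto simp: received_def)
  have par: "(\<Sum>m\<in>#?X. if msg_parent m = i then msg_value m else 0) =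
      (\<Sum>u | u \<in> V \<and> Adj v u \<and> parent (c1 u) = i. c2 u)"
  proof -
    have "(\<Sum>m\<in>#?X. if msg_parent m = i then msg_value m else 0) =
        (\<Sum>u | u \<in> V \<and> Adj v u. if parent (c1 u) = i then c2 u else 0)"
      by (subst sum) (simp add: send_def cong: if_cong)
    also have "\<dots> = (\<Sum>u\<in>{u \<in> {u \<in> V. Adj v u}. parent (c1 u) = i}. c2 u)"
      by (rule sum.inter_filter[OF fin, symmetric])
    also have "\<dots> = (\<Sum>u | u \<in> V \<and> Adj v u \<and> parent (c1 u) = i. c2 u)"
      by (rule sum.cong) auto
    finally show ?thesis .
  qed
  have all: "(\<forall>m\<in>#?X. Q m) \<longleftrightarrow> (\<forall>u\<in>V. Adj v u \<longrightarrow> Q (send (ident u) (c1 u) (c2 u)))" for Q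
    using mem by auto
  have ex: "(\<exists>m\<in>#?X. Q m) \<longleftrightarrow> (\<exists>u\<in>V. Adj v u \<and> Q (send (ident u) (c1 u) (c2 u)))" for Q
    using mem by auto
  show ?thesis
    unfolding accepts_def par all ex sum by (simp only: send_def message.sel)
qed

section \<open>Soundness of the protocol\<close>

text \<open>Claimed depths lie in \<open>{0..<B}\<close> and \<open>step\<close> is at most 1 in
  absolute value, which gives the range from -1 to \<open>B\<close>.\<close>

definition item_space :: "nat \<Rightarrow> (nat \<times> int) set" where
  "item_space B = {..<B} \<times> {-1..int B}"

lemma chain_subset_item_space:
  assumes "c \<in> certs k B"
  shows "set_mset (chain_items k b (positions c) (depths c)) \<subseteq> item_space B"
    "set_mset (chain_preds k b (final c) (positions c) (depths c)) \<subseteq> item_space B"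
proof -
  have len: "length (positions c) = k" "length (depths c) = k" and lt: "final c < B"
    and sub: "set (positions c) \<subseteq> {..<B}" "set (depths c) \<subseteq> {..<B}"
    using assms by (auto simp: certs_iff nat_lists_def)
  have nth: "positions c ! j < B" "depths c ! j < B" if "j < k" for j
    using subsetD[OF sub(1) nth_mem, of j] subsetD[OF sub(2) nth_mem, of j] len that by auto
  have step: "- 1 \<le> step k j" "step k j \<le> 1" for j by (auto simp: step_def)
  have shift: "int (depths c ! j) - step k j \<in> {-1..int B}" if "j < k" for j
    using nth(2)[OF that] step[of j] by auto
  show "set_mset (chain_items k b (positions c) (depths c)) \<subseteq> item_space B"
  proof
    fix p assume "p \<in># chain_items k b (positions c) (depths c)"
    then consider j where "j < k" "p = (positions c ! j, int (depths c ! j))" | "p = (0, 0)"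
      by (auto simp: chain_items_def split: if_splits)
    then show "p \<in> item_space B" using nth lt by cases (auto simp: item_space_def intro: less_imp_le)
  qed
  show "set_mset (chain_preds k b (final c) (positions c) (depths c)) \<subseteq> item_space B"
  proof
    fix p assume "p \<in># chain_preds k b (final c) (positions c) (depths c)"
    then consider j where "j < k" "p = (positions c ! j - 1, int (depths c ! j) - step k j)" | "p = (final c, 0)"
      by (auto simp: chain_preds_def split: if_splits)
    then show "p \<in> item_space B"
    proof cases
      case 1
      then show ?thesis
        using nth(1)[OF 1(1)] shift[OF 1(1)] by (simp add: item_space_def less_imp_diff_less)
    qed (use lt in \<open>simp add: item_space_def\<close>)
  qed
qed

text \<open>Once the multiset identity holds, acceptance under a single random string yields a
  model: \<open>chain_disjoint\<close> and \<open>chain_depth\<close> make the positions disjoint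
  and the depths true, hence the non-neighbours balance in every gap.\<close>

lemma protocol_sound_model:
  assumes k: "k \<ge> 2" and net: "network d V Adj ident N" and c1: "\<And>v. c1 v \<in> certs k B"
    and acc: "\<And>v. v \<in> V \<Longrightarrow> accepts k (ident v) (c1 v) (c2 v) r (received Adj V (\<lambda>u. send (ident u) (c1 u) (c2 u)) v)"
    and eq: "(\<Sum>v\<in>V. chain_items k (leader (c1 v) = ident v) (positions (c1 v)) (depths (c1 v))) =
      (\<Sum>v\<in>V. chain_preds k (leader (c1 v) = ident v) (final (c1 v)) (positions (c1 v)) (depths (c1 v)))"
  shows "k_polygon_circle k V Adj"
proof -
  have fin: "finite V" and sym: "\<And>u v. Adj u v \<Longrightarrow> Adj v u" and AdjV: "\<And>u v. Adj u v \<Longrightarrow> u \<in> V \<and> v \<in> V"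
    and conn: "\<And>u v. u \<in> V \<Longrightarrow> v \<in> V \<Longrightarrow> Adj\<^sup>*\<^sup>* u v" and inj: "inj_on ident V"
    using net unfolding network_def simple_connected_graph_def by blast+
  define xs where "xs v = positions (c1 v)" for v
  define ds where "ds v = depths (c1 v)" for v
  note ok = acc[unfolded accepts_received[OF fin], folded xs_def ds_def]
  have xs: "sorted_wrt (<) (xs v) \<and> length (xs v) = k" if "v \<in> V" for v
    using ok[OF that] c1[of v] by (simp add: xs_def certs_iff nat_lists_def)
  have pos: "x \<ge> 1" if "v \<in> V" "x \<in> set (xs v)" for v x using ok[OF that(1)] that(2) by blast
  have same: "leader (c1 v) = leader (c1 u)" if "u \<in> V" "v \<in> V" for u v
    using conn[OF that]
  proof (induction rule: rtranclp_induct)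
    case (step y z)
    then show ?case using ok[of y] AdjV by metis
  qed simp
  \<comment> \<open>By connectivity all nodes name the same leader, and identifiers are distinct, so
    at most one node takes itself for it.\<close>
  have lead: "u = v" if "u \<in> V" "v \<in> V" "leader (c1 u) = ident u" "leader (c1 v) = ident v" for u v
    using same[OF that(1,2)] that inj by (metis inj_onD)
  have disj: "set (xs u) \<inter> set (xs v) = {}" if "u \<in> V" "v \<in> V" "u \<noteq> v" for u v
    by (rule chain_disjoint[OF fin k xs pos lead eq[folded xs_def ds_def] that])
  have depth: "int (ds v ! j) = depth xs V (xs v ! j)" if "v \<in> V" "j < k" for v j
    by (rule chain_depth[OF fin k xs pos lead eq[folded xs_def ds_def] that])
  have bal: "(\<Sum>u | u \<in> V \<and> \<not> Adj v u. gap_balance (xs u) (xs v ! j) (xs v ! Suc j)) = 0"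
    if v: "v \<in> V" and "Suc j < length (xs v)" for v j
  proof -
    have j: "Suc j < k" using that xs by simp
    let ?g = "\<lambda>u. gap_balance (xs u) (xs v ! j) (xs v ! Suc j)"
    have lt: "xs v ! j < xs v ! Suc j" using xs[OF v] j by (simp add: sorted_wrt_nth_less)
    have "depth xs V (xs v ! Suc j - 1) = int (ds v ! Suc j) - step k (Suc j)"
      using depth_step[where xs = xs, OF fin k xs disj v j] depth[OF v j] lt by simp
    then have "(\<Sum>u\<in>V. ?g u) = int (ds v ! Suc j) - step k (Suc j) - int (ds v ! j)"
      using depth_gap[OF lt, of xs V] depth[OF v, of j] j by simp
    also have "\<dots> = (\<Sum>u | u \<in> V \<and> Adj v u. ?g u)" using ok[OF v] j by blast
    finally have "(\<Sum>u\<in>V. ?g u) = (\<Sum>u | u \<in> V \<and> Adj v u. ?g u)" .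
    moreover have "(\<Sum>u\<in>V. ?g u) = (\<Sum>u | u \<in> V \<and> Adj v u. ?g u) + (\<Sum>u | u \<in> V \<and> \<not> Adj v u. ?g u)"
      using fin by (subst sum.union_disjoint[symmetric]) (auto intro: sum.cong)
    ultimately show ?thesis by simp
  qed
  have ne: "xs v \<noteq> []" if "v \<in> V" for v using xs[OF that] k by auto
  show ?thesis
  proof (rule positions_imp_k_polygon_circle[where A = "\<lambda>v. set (xs v)"])
    show "k > 0" using k by simp
    show "finite (set (xs v)) \<and> card (set (xs v)) = k" if "v \<in> V" for v
      using xs[OF that] by (simp add: distinct_card strict_sorted_iff)
    show "Adj u v \<longleftrightarrow> interleaved (set (xs u)) (set (xs v))" if "u \<in> V" "v \<in> V" "u \<noteq> v" for u v
    proof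
      assume "Adj u v"
      then show "interleaved (set (xs u)) (set (xs v))" using ok[OF that(1)] that(2) by blast
    next
      assume "interleaved (set (xs u)) (set (xs v))"
      then show "Adj u v"
        using balanced_gaps_imp_not_interleaved[where xs = xs and Adj = Adj, OF fin _ ne disj sym bal that] xs
        by blast
    qed
  qed (use fin disj in auto)
qed

text \<open>The first certificates decide between two cases. If the committed multisets agree, no
  string is accepted, by \<open>protocol_sound_model\<close>. Otherwise acceptance makes the two
  weight sums equal, which has probability at most 1/4.\<close>

lemma protocol_sound:
  assumes k: "k \<ge> 2" and net: "network d V Adj ident N" and ncls: "\<not> k_polygon_circle k V Adj"
    and c1: "\<And>v. c1 v \<in> certs k B"
  shows "prob_bits (hash_length (item_space B)) (\<lambda>r. \<exists>c2. (\<forall>v. c2 v \<in> {- int B..<int B}) \<and>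
     (\<forall>v\<in>V. accepts k (ident v) (c1 v) (c2 v) r (received Adj V (\<lambda>u. send (ident u) (c1 u) (c2 u)) v))) \<le> 1/3"
    (is "prob_bits ?l ?acc \<le> _")
proof -
  have fin: "finite V" and sym: "\<And>u v. Adj u v \<Longrightarrow> Adj v u" and inj: "inj_on ident V"
    using net unfolding network_def simple_connected_graph_def by blast+
  define P where "P v = chain_items k (leader (c1 v) = ident v) (positions (c1 v)) (depths (c1 v))" for v
  define Q where "Q v = chain_preds k (leader (c1 v) = ident v) (final (c1 v)) (positions (c1 v)) (depths (c1 v))" for v
  show ?thesis
  proof (cases "(\<Sum>v\<in>V. P v) = (\<Sum>v\<in>V. Q v)")
    case True
    have none: "\<not> ?acc r" for r
      using protocol_sound_model[where ?c1.0 = c1 and r = r, OF k net c1] True ncls unfolding P_def Q_def by blast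
    have "prob_bits ?l ?acc \<le> prob_bits ?l (\<lambda>_. False)" by (rule prob_bits_mono) (use none in blast)
    also have "\<dots> = 0" by (simp add: prob_bits_def)
    finally show ?thesis by simp
  next
    case False
    have sub: "set_mset (\<Sum>v\<in>V. P v) \<subseteq> item_space B" "set_mset (\<Sum>v\<in>V. Q v) \<subseteq> item_space B"
      unfolding P_def Q_def by (intro sum_mset_subset[OF fin] chain_subset_item_space[OF c1])+
    have finI: "finite (item_space B)" by (simp add: item_space_def)
    have "prob_bits ?l ?acc \<le> prob_bits ?l (\<lambda>r. (\<Sum>p\<in>#(\<Sum>v\<in>V. P v). hash r p) = (\<Sum>p\<in>#(\<Sum>v\<in>V. Q v). hash r p))"
    proof (rule prob_bits_mono)
      fix r assume "?acc r"
      then obtain c2 where "\<forall>v\<in>V. accepts k (ident v) (c1 v) (c2 v) r (received Adj V (\<lambda>u. send (ident u) (c1 u) (c2 u)) v)"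
        by blast
      note ok = this[unfolded accepts_received[OF fin]]
      have "(\<Sum>v\<in>V. local_sum k (ident v) (c1 v) r) = 0"
      proof (rule aggregation_sound[OF fin inj sym, where s = c2 and par = "\<lambda>u. parent (c1 u)"])
        show "c2 v = local_sum k (ident v) (c1 v) r + (\<Sum>u | u \<in> V \<and> Adj v u \<and> parent (c1 u) = ident v. c2 u)"
          if "v \<in> V" for v using ok that by blast
        show "c2 v = 0 \<or> (\<exists>u\<in>V. Adj v u \<and> ident u = parent (c1 v))" if "v \<in> V" for v
          using ok that by (metis (no_types, lifting))
      qed
      then have "(\<Sum>v\<in>V. \<Sum>p\<in>#P v. hash r p) - (\<Sum>v\<in>V. \<Sum>p\<in>#Q v. hash r p) = 0"
        by (simp add: local_sum_def P_def Q_def sum_subtractf)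
      then show "(\<Sum>p\<in>#(\<Sum>v\<in>V. P v). hash r p) = (\<Sum>p\<in>#(\<Sum>v\<in>V. Q v). hash r p)"
        by (simp add: sum_mset_image_sum)
    qed
    also have "\<dots> \<le> 1/4" by (rule hash_collision[OF finI sub False])
    finally show ?thesis by simp
  qed
qed

section \<open>Completeness of the protocol\<close>

text \<open>A node holds at most \<open>k + 1\<close> pairs of weight at most 3; this is what bounds
  the aggregated values.\<close>

lemma chain_sum_bounds:
  "0 \<le> (\<Sum>p\<in>#chain_items k b xs ds. hash r p)" "(\<Sum>p\<in>#chain_items k b xs ds. hash r p) \<le> 3 * (int k + 1)"
  "0 \<le> (\<Sum>p\<in>#chain_preds k b e xs ds. hash r p)" "(\<Sum>p\<in>#chain_preds k b e xs ds. hash r p) \<le> 3 * (int k + 1)"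
proof -
  have ub: "(\<Sum>j<k. hash r (f j)) \<le> 3 * int k" for f :: "nat \<Rightarrow> nat \<times> int"
  proof -
    have "(\<Sum>j<k. hash r (f j)) \<le> (\<Sum>j<k. 3)" by (rule sum_mono) (rule hash_bounds)
    then show ?thesis by simp
  qed
  have lb: "0 \<le> (\<Sum>j<k. hash r (f j))" for f :: "nat \<Rightarrow> nat \<times> int"
    by (rule sum_nonneg) (simp add: hash_bounds)
  show "0 \<le> (\<Sum>p\<in>#chain_items k b xs ds. hash r p)" "0 \<le> (\<Sum>p\<in>#chain_preds k b e xs ds. hash r p)"
    unfolding sum_chain_items sum_chain_preds by (intro add_nonneg_nonneg lb; simp add: hash_bounds)+
  show "(\<Sum>p\<in>#chain_items k b xs ds. hash r p) \<le> 3 * (int k + 1)"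
    using ub[of "\<lambda>j. (xs ! j, int (ds ! j))"] hash_bounds(2)[of r "(0 :: nat, 0 :: int)"]
    unfolding sum_chain_items by (cases b) auto
  show "(\<Sum>p\<in>#chain_preds k b e xs ds. hash r p) \<le> 3 * (int k + 1)"
    using ub[of "\<lambda>j. (xs ! j - 1, int (ds ! j) - step k j)"] hash_bounds(2)[of r "(e, 0 :: int)"]
    unfolding sum_chain_preds by (cases b) auto
qed

text \<open>The honest prover sends true ranks, true depths and a spanning tree. The total of the
  local sums is 0 for every string, so suitable second certificates exist for each \<open>r\<close>
  and acceptance is certain.\<close>

lemma protocol_complete:
  assumes k: "k \<ge> 2" and d: "d \<ge> 1" and net: "network d V Adj ident N" and cls: "k_polygon_circle k V Adj"
    and B: "\<And>e. e \<le> 8 * (k + 1) * N ^ d \<Longrightarrow> e < B"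
  shows "\<exists>c1. (\<forall>v\<in>V. c1 v \<in> certs k B) \<and> (\<forall>r. \<exists>c2. (\<forall>v\<in>V. c2 v \<in> {- int B..<int B}) \<and>
     (\<forall>v\<in>V. accepts k (ident v) (c1 v) (c2 v) r (received Adj V (\<lambda>u. send (ident u) (c1 u) (c2 u)) v)))"
proof -
  have gr: "simple_connected_graph V Adj" and inj: "inj_on ident V"
    and id_le: "\<And>v. v \<in> V \<Longrightarrow> ident v \<le> card V ^ d" and VN: "card V \<le> N"
    using net unfolding network_def by blast+
  have fin: "finite V" and "V \<noteq> {}" and sym: "\<And>u v. Adj u v \<Longrightarrow> Adj v u"
    and AdjV: "\<And>u v. Adj u v \<Longrightarrow> u \<in> V \<and> v \<in> V" and irr: "\<And>u. \<not> Adj u u"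
    using gr unfolding simple_connected_graph_def by blast+
  have "k > 0" using k by simp
  obtain T :: "nat \<Rightarrow> real set" where
    T: "\<forall>v\<in>V. T v \<subseteq> {0..<2*pi} \<and> finite (T v) \<and> card (T v) = k"
    and AT: "\<forall>u\<in>V. \<forall>v\<in>V. u \<noteq> v \<longrightarrow> (Adj u v \<longleftrightarrow> T u \<inter> T v \<noteq> {} \<or> interleaved (T u) (T v))"
    using cls[unfolded k_polygon_circle_iff_angles[OF \<open>k > 0\<close>]] by (elim exE conjE) (rule that)
  obtain A :: "nat \<Rightarrow> nat set" where
    cardA: "\<And>v. v \<in> V \<Longrightarrow> card (A v) = k" and disjA: "disjoint_family_on A V"
    and unA: "(\<Union>v\<in>V. A v) = {1..k * card V}"
    and AA: "\<And>u v. u \<in> V \<Longrightarrow> v \<in> V \<Longrightarrow> u \<noteq> v \<Longrightarrow>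
        interleaved (A u) (A v) \<longleftrightarrow> T u \<inter> T v \<noteq> {} \<or> interleaved (T u) (T v)"
    by (rule angle_model_imp_positions[OF k fin T[rule_format]]) blast+
  have Adj_iff: "Adj u v \<longleftrightarrow> interleaved (A u) (A v)" if "u \<in> V" "v \<in> V" "u \<noteq> v" for u v
    using AA[OF that] AT that by simp
  define xs where "xs v = sorted_list_of_set (A v)" for v
  define ds where "ds v = map (\<lambda>x. nat (depth xs V x)) (xs v)" for v
  have finA: "finite (A v)" if "v \<in> V" for v
    using cardA[OF that] \<open>k > 0\<close> card.infinite by fastforce
  have set_xs: "set (xs v) = A v" if "v \<in> V" for v using finA[OF that] by (simp add: xs_def)
  have xs: "sorted_wrt (<) (xs v) \<and> length (xs v) = k" if "v \<in> V" for v
    using cardA[OF that] by (simp add: xs_def)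
  have ne: "xs v \<noteq> []" if "v \<in> V" for v using xs[OF that] k by auto
  have rng: "x \<in> {1..k * card V}" if "v \<in> V" "x \<in> set (xs v)" for v x
    using that unA set_xs by blast
  have pos: "x \<ge> 1" if "v \<in> V" "x \<in> set (xs v)" for v x using rng[OF that] by simp
  have disj: "set (xs u) \<inter> set (xs v) = {}" if "u \<in> V" "v \<in> V" "u \<noteq> v" for u v
    using disjA that set_xs unfolding disjoint_family_on_def by simp
  have depth_bounds: "0 \<le> depth xs V x" "depth xs V x \<le> int (card V)" for x
  proof -
    have le: "hd (xs u) \<le> last (xs u)" if "u \<in> V" for u
      using sorted_hd_last_bounds(1) xs[OF that] ne[OF that] by simp
    show "0 \<le> depth xs V x" unfolding depth_def
      by (rule sum_nonneg) (use le in \<open>force simp: of_bool_def\<close>)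
    have "depth xs V x \<le> (\<Sum>u\<in>V. 1)" unfolding depth_def
      by (rule sum_mono) (auto simp: of_bool_def)
    then show "depth xs V x \<le> int (card V)" by simp
  qed
  have ds: "int (ds v ! j) = depth xs V (xs v ! j)" if "v \<in> V" "j < k" for v j
    using xs[OF that(1)] that(2) depth_bounds(1) by (simp add: ds_def)
  \<comment> \<open>Any node can serve as leader and as root of the tree.\<close>
  obtain l where l: "l \<in> V" using \<open>V \<noteq> {}\<close> by blast
  obtain par where par_l: "par l = l" and par: "\<forall>v\<in>V - {l}. par v \<in> V \<and> Adj v (par v)"
    and agg: "\<forall>f :: nat \<Rightarrow> int. (\<Sum>v\<in>V. f v) = 0 \<longrightarrow> (\<exists>s. s l = 0 \<and>
       (\<forall>v\<in>V. s v = f v + (\<Sum>u | u \<in> V \<and> Adj v u \<and> par u = v. s u) \<and> \<bar>s v\<bar> \<le> (\<Sum>v\<in>V. \<bar>f v\<bar>)))"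
    using aggregation_complete[OF gr l] by (elim exE conjE) (rule that)
  have par_V: "par v \<in> V" if "v \<in> V" for v using par par_l that by (cases "v = l") auto
  define c1 where "c1 v = Cert (ident l) (ident (par v)) (k * card V) (xs v) (ds v)" for v
  have sel: "leader (c1 v) = ident l" "parent (c1 v) = ident (par v)" "final (c1 v) = k * card V"
    "positions (c1 v) = xs v" "depths (c1 v) = ds v" for v
    by (simp_all add: c1_def)
  have "card V ^ d \<le> N ^ d" using VN by (rule power_mono) simp
  have "card V \<le> N ^ d" using VN d self_le_power[of N d] \<open>V \<noteq> {}\<close> fin
    by (metis card_gt_0_iff less_eq_Suc_le le_trans less_le_trans One_nat_def)
  have id_lt: "ident v < B" if "v \<in> V" for v
  proof (rule B)
    have "ident v \<le> 1 * N ^ d" using id_le[OF that] \<open>card V ^ d \<le> N ^ d\<close> by simp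
    also have "\<dots> \<le> 8 * (k + 1) * N ^ d" by (rule mult_le_mono1) simp
    finally show "ident v \<le> 8 * (k + 1) * N ^ d" .
  qed
  have lin_lt: "m * card V < B" if "m \<le> 8 * (k + 1)" for m
    using mult_le_mono[OF that \<open>card V \<le> N ^ d\<close>] by (rule B)
  have cert: "c1 v \<in> certs k B" if v: "v \<in> V" for v
  proof -
    have "set (xs v) \<subseteq> {..<B}" using rng[OF v] lin_lt[of k] by fastforce
    moreover have "set (ds v) \<subseteq> {..<B}"
    proof -
      have "nat (depth xs V x) < B" for x using depth_bounds(2)[of x] lin_lt[of 1] by simp
      then show ?thesis by (auto simp: ds_def)
    qed
    ultimately show ?thesis
      using id_lt[OF l] id_lt[OF par_V[OF v]] lin_lt[of k] xs[OF v]
      by (simp add: certs_iff sel nat_lists_def ds_def)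
  qed
  have lead: "ident l = ident v \<longleftrightarrow> v = l" if "v \<in> V" for v
    using inj l that by (auto simp: inj_on_def)
  have "\<exists>c2. (\<forall>v\<in>V. c2 v \<in> {- int B..<int B}) \<and>
     (\<forall>v\<in>V. accepts k (ident v) (c1 v) (c2 v) r (received Adj V (\<lambda>u. send (ident u) (c1 u) (c2 u)) v))" for r
  proof -
    define f where "f v = local_sum k (ident v) (c1 v) r" for v
    have "(\<Sum>v\<in>V. f v) = 0"
      unfolding f_def local_sum_def sel
      by (rule chain_complete[OF fin k xs pos disj _ ds l lead])
         (use unA set_xs in auto)
    then obtain s where s_l: "s l = 0"
      and s: "\<And>v. v \<in> V \<Longrightarrow> s v = f v + (\<Sum>u | u \<in> V \<and> Adj v u \<and> par u = v. s u)"
      and s_le: "\<And>v. v \<in> V \<Longrightarrow> \<bar>s v\<bar> \<le> (\<Sum>v\<in>V. \<bar>f v\<bar>)"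
      using agg by blast
    \<comment> \<open>\<open>f v\<close> is the difference of two numbers between 0 and this
      bound.\<close>
    have "\<bar>f v\<bar> \<le> 3 * (int k + 1)" for v
      unfolding f_def local_sum_def abs_le_iff
      by (intro conjI; smt (verit) chain_sum_bounds)
    then have "(\<Sum>v\<in>V. \<bar>f v\<bar>) \<le> (\<Sum>v\<in>V. 3 * (int k + 1))" by (intro sum_mono)
    also have "\<dots> = int (3 * (k + 1) * card V)" by (simp add: algebra_simps)
    also have "\<dots> < int B" using lin_lt[of "3 * (k + 1)"] by (simp only: of_nat_less_iff)
    finally have s_lt: "\<bar>s v\<bar> < int B" if "v \<in> V" for v using s_le[OF that] by linarith
    have "accepts k (ident v) (c1 v) (s v) r (received Adj V (\<lambda>u. send (ident u) (c1 u) (s u)) v)"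
      if v: "v \<in> V" for v
      unfolding accepts_received[OF fin] sel
    proof (intro conjI)
      show "sorted_wrt (<) (xs v)" using xs[OF v] by blast
      show "\<forall>x\<in>set (xs v). 1 \<le> x" using pos[OF v] by blast
      show "\<forall>u\<in>V. Adj v u \<longrightarrow> ident l = ident l \<and> interleaved (set (xs v)) (set (xs u))"
        using Adj_iff v irr by (metis set_xs)
      show "\<forall>j. Suc j < k \<longrightarrow> int (ds v ! Suc j) - step k (Suc j) - int (ds v ! j) =
        (\<Sum>u | u \<in> V \<and> Adj v u. gap_balance (xs u) (xs v ! j) (xs v ! Suc j))"
      proof (intro allI impI)
        fix j assume j: "Suc j < k"
        let ?g = "\<lambda>u. gap_balance (xs u) (xs v ! j) (xs v ! Suc j)"
        have lt: "xs v ! j < xs v ! Suc j" using xs[OF v] j by (simp add: sorted_wrt_nth_less)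
        have "depth xs V (xs v ! Suc j - 1) = int (ds v ! Suc j) - step k (Suc j)"
          using depth_step[where xs = xs, OF fin k xs disj v j] ds[OF v j] lt by simp
        then have "int (ds v ! Suc j) - step k (Suc j) - int (ds v ! j) = (\<Sum>u\<in>V. ?g u)"
          using depth_gap[OF lt, of xs V] ds[OF v, of j] j by simp
        \<comment> \<open>Non-neighbours contribute nothing: the node itself has no vertex inside
          its own gap, and the others do not interleave with it.\<close>
        also have "\<dots> = (\<Sum>u | u \<in> V \<and> Adj v u. ?g u)"
        proof (rule sum.mono_neutral_right)
          show "\<forall>u\<in>V - {u. u \<in> V \<and> Adj v u}. ?g u = 0"
          proof
            fix u assume "u \<in> V - {u. u \<in> V \<and> Adj v u}"
            then have u: "u \<in> V" "\<not> Adj v u" by auto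
            have mem: "xs v ! j \<in> set (xs v)" "xs v ! Suc j \<in> set (xs v)" using xs[OF v] j by auto
            show "?g u = 0"
            proof (cases "u = v")
              case True
              have "\<not> (xs v ! j < x \<and> x < xs v ! Suc j)" if "x \<in> set (xs v)" for x
                using consecutive_gap_empty[of "xs v" j x] xs[OF v] j that by simp
              then show ?thesis
                using hd_in_set[OF ne[OF v]] last_in_set[OF ne[OF v]] True by (auto simp: gap_balance_def)
            next
              case False
              then have "\<not> interleaved (set (xs v)) (set (xs u))"
                using Adj_iff u v set_xs by metis
              then show ?thesis
                using gap_balance_eq_0[OF ne[OF u(1)] _ mem] xs[OF u(1)] disj[OF v u(1)] False by simp
            qed
          qed
        qed (use fin in auto)
        finally show "int (ds v ! Suc j) - step k (Suc j) - int (ds v ! j) = (\<Sum>u | u \<in> V \<and> Adj v u. ?g u)" .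
      qed
      \<comment> \<open>Distinct identifiers let the parent's identifier stand for the
        parent.\<close>
      have "{u. u \<in> V \<and> Adj v u \<and> ident (par u) = ident v} = {u. u \<in> V \<and> Adj v u \<and> par u = v}"
        using inj v par_V by (auto simp: inj_on_def)
      then show "s v = local_sum k (ident v) (c1 v) r + (\<Sum>u | u \<in> V \<and> Adj v u \<and> ident (par u) = ident v. s u)"
        using s[OF v] by (simp add: f_def)
      show "if ident l = ident v then s v = 0 else \<exists>u\<in>V. Adj v u \<and> ident u = ident (par v)"
        using lead[OF v] s_l par v by auto
    qed
    moreover have "s v \<in> {- int B..<int B}" if "v \<in> V" for v using s_lt[OF that] by auto
    ultimately show ?thesis by (intro exI[of _ s]) simp
  qed
  then show ?thesis using cert by blast
qed

theorem theorem4: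
  fixes k d :: nat
  assumes "k \<ge> 2" and "d \<ge> 1"
  shows "dMAM_log d (k_polygon_circle k)"
proof -
  define B :: "nat \<Rightarrow> nat" where "B N = 2 ^ width k d N" for N
  have lt: "e < B N" if "e \<le> 8 * (k + 1) * N ^ d" for e N
    using less_two_power_width[OF that] by (simp add: B_def)
  show ?thesis
  proof (rule dMAM_logI[OF \<open>d \<ge> 1\<close>, where ?C1.0 = "\<lambda>N. certs k (B N)" and ?C2.0 = "\<lambda>N. {- int (B N)..<int (B N)}"
        and M = "\<lambda>N. messages k (B N)" and q = "\<lambda>N. (2 * k + 4) * Suc (width k d N)"
        and msg = send and dec = "\<lambda>N. accepts k" and L = "\<lambda>N. hash_length (item_space (B N))"])
    show "real ((2 * k + 4) * Suc (width k d N)) \<le> real ((2 * k + 4) * (d + 8 * k + 9)) * (1 + log 2 (real N))" for N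
      by (rule width_log_bound)
    show "send i a b \<in> messages k (B N)"
      if "i \<le> N ^ d" "a \<in> certs k (B N)" "b \<in> {- int (B N)..<int (B N)}" for N i a b
    proof -
      have "i \<le> 1 * N ^ d" using that by simp
      also have "\<dots> \<le> 8 * (k + 1) * N ^ d" by (rule mult_le_mono1) simp
      finally have "i < B N" by (rule lt)
      then show ?thesis using that by (simp add: messages_iff certs_iff send_def)
    qed
    show "0 \<le> real ((2 * k + 4) * (d + 8 * k + 9))" by (rule of_nat_0_le_iff)
  qed (fact certs_size[OF B_def] values_size[OF B_def] messages_size[OF B_def]
      | (rule protocol_complete[OF assms _ _ lt]; assumption) | (rule protocol_sound[OF assms(1)]; assumption))+
qed

end
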